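(* Let $\mathcal{L}_1,\mathcal{L}_2$ be libraries, $I_1,I_2,I\subseteq\Sigma$, and $\Gamma=\{\{p^m\}\,m\,\{q^m\}\mid m\in M\}$, $\Gamma'=\{\{r^m\}\,m\,\{s^m\}\mid m\in M\}$ method specifications. Assume (1) $\Gamma'$ extends $\Gamma$; (2) for $i\in\{1,2\}$, $\mathcal{L}_i:\Gamma$ is safe for $I_i$ and $\mathcal{L}_i:\Gamma'$ is safe for $I_i*I$; (3) $(\mathcal{L}_1:\Gamma,I_1)\sqsubseteq(\mathcal{L}_2:\Gamma,I_2)$; (4) for every $\sigma_0\in I_1$, $\sigma_0'\in I$ and $\lambda\in[\![\mathcal{L}_1:\Gamma']\!](\sigma_0*\sigma_0')$, we have $E(\lceil\mathsf{history}(\lambda)\rceil_\Gamma)\sigma_0'\neq\top$. Then $(\mathcal{L}_1:\Gamma',I_1*I)\sqsubseteq(\mathcal{L}_2:\Gamma',I_2*I)$.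
   Context: Separation algebra. $\Sigma$ is a set with a partial commutative, associative (both sides defined and equal or both undefined), cancellative binary operation $*$ with unit $e$; $(\sigma_1*\sigma_2)\downarrow$ means defined; $p*q=\{\sigma_1*\sigma_2\mid\sigma_1\in p,\sigma_2\in q,(\sigma_1*\sigma_2)\downarrow\}$; $\sigma_2\setminus\sigma_1$ is the unique $\sigma$ with $\sigma_2=\sigma*\sigma_1$ (undefined if none). Footprint $\delta(\sigma)=\{\sigma'\mid\forall\sigma''.(\sigma'*\sigma'')\downarrow\iff(\sigma*\sigma'')\downarrow\}$; $\delta(\sigma_1)\circ\delta(\sigma_2)=\delta(\sigma_1*\sigma_2)$ if defined. Standing assumption: $*$ is cancellative on footprints (if $\sigma_1*\sigma_2,\sigma_1'*\sigma_2'$ defined, $\delta(\sigma_1*\sigma_2)=\delta(\sigma_1'*\sigma_2')$ and $\delta(\sigma_1)=\delta(\sigma_1')$ imply $\delta(\sigma_2)=\delta(\sigma_2')$). $l_2\mathbin{\backslash\!\backslash}l_1=\delta(\sigma)$ if $l_1=\delta(\sigma_1),l_2=\delta(\sigma_2),\sigma_2=\sigma_1*\sigma$; $l_1\preceq l_2$ iff $l_2\mathbin{\backslash\!\backslash}l_1$ defined. Histories: finite sequences of interface actions $(t,\mathsf{call}\,m(\sigma))$, $(t,\mathsf{ret}\,m(\sigma))$ whose projection to each thread alternates calls and returns of matching methods starting with a call. $[\![\varepsilon]\!]^\sharp l=l$, $[\![H\psi]\!]^\sharp l=([\![H]\!]^\sharp l)\circ\delta(\sigma)$ for a call carrying $\sigma$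 and $([\![H]\!]^\sharp l)\mathbin{\backslash\!\backslash}\delta(\sigma)$ for a return carrying $\sigma$; $H$ balanced from $l$ iff defined. $H\sqsubseteq H'$ iff there is a bijection $\rho$ of positions with $H(i)=H'(\rho(i))$ and, for $i<j$ with $H(i),H(j)$ by the same thread or $H(i)$ a return and $H(j)$ a call, $\rho(i)<\rho(j)$. For balanced pairs, $(l,H)\sqsubseteq(l',H')$ iff $l'\preceq l$ and $H\sqsubseteq H'$; for sets, $\mathcal{H}_1\sqsubseteq\mathcal{H}_2$ iff each element of $\mathcal{H}_1$ is $\sqsubseteq$ some element of $\mathcal{H}_2$. Primitive commands have transformers $f^t_c:\Sigma\to\mathcal{P}(\Sigma)\cup\{\top\}$ satisfying Footprint Preservation ($\sigma'\in f^t_c(\sigma)\Rightarrow\delta(\sigma')=\delta(\sigma)$) and Strong Locality ($(\sigma_1*\sigma_2)\downarrow$ and $f^t_c(\sigma_1)\ne\top$ imply $f^t_c(\sigma_1*\sigma_2)=f^t_c(\sigma_1)*\{\sigma_2\}$). Libraries $\mathcal{L}=\{m=C_m\mid m\in M\}$ with bodies in $C::=c\mid C;C\mid C+C\mid C^*$. A predicate $r\subseteq\Sigma$ is precise if each $\sigma$ has at most one $\sigma_1\in r$ with $\sigma=\sigma_1*\sigma_2$; then $\sigma\setminus r=\sigma_2$. A parameterised predicate maps threads $t$ to predicates $p_t$. A method specification is a set of triples $\{p\}m\{q\}$ (at most one per method), $p,q$ precise parameterised predicates. $\Gamma'$ extends $\Gamma$ if $r^m_t\subseteq p^m_t*\Sigma$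 and $s^m_t\subseteq q^m_t*\Sigma$ for all $m,t$. Library-local semantics $[\![\mathcal{L}:\Gamma]\!]\sigma$. Trace set: prefix closure of the union over $k\ge1$ of all interleavings of $k$ threads, each thread $t$ repeatedly (finitely often) choosing a method $m$ and producing $(t,\mathsf{call}\,m)\,\tau\,(t,\mathsf{ret}\,m)$ with $\tau$ a sequence of actions $(t,c)$ generated by the body $C_m$ ($[c]_t=\{(t,c)\}$, $+$ as union, $;$ as concatenation, ${}^*$ as Kleene star). Evaluation from a state, giving (state, annotated action) pairs or $\top$: $(t,c)$ gives $\top$ if $f^t_c(\sigma)=\top$ else $\{(\sigma',(t,c))\mid\sigma'\in f^t_c(\sigma)\}$; for $\{p\}m\{q\}\in\Gamma$, $(t,\mathsf{call}\,m)$ gives $\{(\sigma*\sigma_p,(t,\mathsf{call}\,m(\sigma_p)))\mid\sigma_p\in p_t,(\sigma*\sigma_p)\downarrow\}$ and $(t,\mathsf{ret}\,m)$ gives $\top$ if $\sigma\setminus q_t$ undefined else $\{(\sigma\setminus q_t,(t,\mathsf{ret}\,m(\sigma_q)))\}$ with $\sigma_q\in q_t$ the unique substate. A trace is evaluated step by step, giving $\top$ if any step from a reachable state does. $[\![\mathcal{L}:\Gamma]\!]\sigma=\top$ if some trace evaluates to $\top$ from $\sigma$, else the set of resulting annotated traces. Safe at $\sigma$ / for $I$: $\ne\top$ at $\sigma$ / at all $\sigma\in I$. $\mathsf{history}(\lambda)$ is the subsequence of interface actions. $\mathsf{interf}(\mathcal{L}:\Gamma,I)=\{(\delta(\sigma_0),\mathsf{history}(\lambda))\mid\sigma_0\in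 I,\lambda\in[\![\mathcal{L}:\Gamma]\!]\sigma_0\}$, and $(\mathcal{L}_1:\Gamma,I_1)\sqsubseteq(\mathcal{L}_2:\Gamma,I_2)$ iff $\mathsf{interf}(\mathcal{L}_1:\Gamma,I_1)\sqsubseteq\mathsf{interf}(\mathcal{L}_2:\Gamma,I_2)$. Operations: $\lceil(t,\mathsf{call}\,m(\sigma))\rceil_\Gamma=(t,\mathsf{call}\,m(\sigma\setminus p^m_t))$, $\lceil(t,\mathsf{ret}\,m(\sigma))\rceil_\Gamma=(t,\mathsf{ret}\,m(\sigma\setminus q^m_t))$, lifted to histories actionwise. $E(H):\Sigma\to\Sigma\cup\{\top\}$: $E(\varepsilon)\sigma=\sigma$; $E(H\psi)\sigma=\top$ if $E(H)\sigma=\top$; otherwise, with $\sigma'=E(H)\sigma$, for $\psi=(t,\mathsf{call}\,m(\sigma_0))$ it is $\sigma'*\sigma_0$ if defined else $\top$, and for $\psi=(t,\mathsf{ret}\,m(\sigma_0))$ it is $\sigma'\setminus\sigma_0$ if defined else $\top$. *)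

theory Defs
  imports Main "HOL-Library.Sublist"
begin

section \<open>Separation algebras and footprints\<close>

text \<open>The carrier is the whole type; an undefined composition is \<^term>\<open>None\<close>.\<close>

class sep_algebra =
  fixes sep_comp :: "'a \<Rightarrow> 'a \<Rightarrow> 'a option"  (infixl "\<odot>" 70)
    and sep_unit :: 'a
  assumes sep_comm: "a \<odot> b = b \<odot> a"
    and sep_assoc: "Option.bind (a \<odot> b) (\<lambda>x. x \<odot> c) = Option.bind (b \<odot> c) (\<lambda>x. a \<odot> x)"
    and sep_cancel: "a \<odot> b = Some x \<Longrightarrow> a \<odot> c = Some x \<Longrightarrow> b = c"
    and sep_unit: "a \<odot> sep_unit = Some a"
begin

definition footprint :: "'a \<Rightarrow> 'a set" where
  "footprint \<sigma> = {\<sigma>'. \<forall>\<sigma>''. \<sigma>' \<odot> \<sigma>'' \<noteq> None \<longleftrightarrow> \<sigma> \<odot> \<sigma>'' \<noteq> None}"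

end

class footprint_sep_algebra = sep_algebra +
  assumes footprint_cancel:
    "\<sigma>1 \<odot> \<sigma>2 = Some \<sigma> \<Longrightarrow> \<sigma>1' \<odot> \<sigma>2' = Some \<sigma>' \<Longrightarrow>
     footprint \<sigma> = footprint \<sigma>' \<Longrightarrow> footprint \<sigma>1 = footprint \<sigma>1' \<Longrightarrow>
     footprint \<sigma>2 = footprint \<sigma>2'"

definition pred_comp :: "'s::sep_algebra set \<Rightarrow> 's set \<Rightarrow> 's set"  (infixl "\<star>" 70) where
  "p \<star> q = {\<sigma>. \<exists>\<sigma>1\<in>p. \<exists>\<sigma>2\<in>q. \<sigma>1 \<odot> \<sigma>2 = Some \<sigma>}"

definition state_diff :: "'s::sep_algebra \<Rightarrow> 's \<Rightarrow> 's option" where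
  "state_diff \<sigma>2 \<sigma>1 =
     (if \<exists>\<sigma>. \<sigma> \<odot> \<sigma>1 = Some \<sigma>2 then Some (THE \<sigma>. \<sigma> \<odot> \<sigma>1 = Some \<sigma>2) else None)"

definition precise :: "'s::sep_algebra set \<Rightarrow> bool" where
  "precise r \<longleftrightarrow>
     (\<forall>\<sigma> \<sigma>1 \<sigma>1' \<sigma>2 \<sigma>2'. \<sigma>1 \<in> r \<longrightarrow> \<sigma>1' \<in> r \<longrightarrow>
        \<sigma>1 \<odot> \<sigma>2 = Some \<sigma> \<longrightarrow> \<sigma>1' \<odot> \<sigma>2' = Some \<sigma> \<longrightarrow> \<sigma>1 = \<sigma>1')"

text \<open>The description below is unique only for precise \<open>r\<close>.\<close>

definition pred_diff :: "'s::sep_algebra \<Rightarrow> 's set \<Rightarrow> 's option" where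
  "pred_diff \<sigma> r =
     (if \<exists>\<sigma>1\<in>r. \<exists>\<sigma>2. \<sigma>1 \<odot> \<sigma>2 = Some \<sigma>
      then Some (THE \<sigma>2. \<exists>\<sigma>1\<in>r. \<sigma>1 \<odot> \<sigma>2 = Some \<sigma>) else None)"

text \<open>
  Footprints are represented as sets of states, namely the elements of
  \<^term>\<open>range footprint\<close>.  The partial operations below are independent of the chosen
  representatives, see the lemmas \<open>fp_comp_footprint\<close> and \<open>fp_diff_footprint\<close>.
\<close>

definition fp_comp :: "'s::footprint_sep_algebra set \<Rightarrow> 's set \<Rightarrow> 's set option" where
  "fp_comp l1 l2 =
     (if \<exists>\<sigma>1 \<sigma>2 \<sigma>. l1 = footprint \<sigma>1 \<and> l2 = footprint \<sigma>2 \<and> \<sigma>1 \<odot> \<sigma>2 = Some \<sigma>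
      then Some (THE l. \<exists>\<sigma>1 \<sigma>2 \<sigma>. l1 = footprint \<sigma>1 \<and> l2 = footprint \<sigma>2 \<and>
                          \<sigma>1 \<odot> \<sigma>2 = Some \<sigma> \<and> l = footprint \<sigma>)
      else None)"

definition fp_diff :: "'s::footprint_sep_algebra set \<Rightarrow> 's set \<Rightarrow> 's set option" where
  "fp_diff l2 l1 =
     (if \<exists>\<sigma>1 \<sigma>2 \<sigma>. l1 = footprint \<sigma>1 \<and> l2 = footprint \<sigma>2 \<and> \<sigma>1 \<odot> \<sigma> = Some \<sigma>2
      then Some (THE l. \<exists>\<sigma>1 \<sigma>2 \<sigma>. l1 = footprint \<sigma>1 \<and> l2 = footprint \<sigma>2 \<and>
                          \<sigma>1 \<odot> \<sigma> = Some \<sigma>2 \<and> l = footprint \<sigma>)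
      else None)"

definition fp_le :: "'s::footprint_sep_algebra set \<Rightarrow> 's set \<Rightarrow> bool"  (infix "\<preceq>" 50) where
  "l1 \<preceq> l2 \<longleftrightarrow> fp_diff l2 l1 \<noteq> None"

lemma footprint_eq_iff:
  "footprint a = footprint b \<longleftrightarrow> (\<forall>c. a \<odot> c \<noteq> None \<longleftrightarrow> b \<odot> c \<noteq> None)"
  (is "?L \<longleftrightarrow> ?R")
proof
  assume ?L
  moreover have "a \<in> footprint a" by (simp add: footprint_def)
  ultimately have "a \<in> footprint b" by simp
  then show ?R by (simp add: footprint_def)
qed (simp add: footprint_def)

lemma footprint_eq_comp_right:
  fixes a a' b x :: "'s::sep_algebra"
  assumes "footprint a = footprint a'" "a \<odot> b = Some x"
  obtains x' where "a' \<odot> b = Some x'" "footprint x = footprint x'"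
proof -
  obtain x' where x': "a' \<odot> b = Some x'"
    using assms by (auto simp: footprint_eq_iff)
  have "x \<odot> c \<noteq> None \<longleftrightarrow> x' \<odot> c \<noteq> None" for c
  proof -
    have "x \<odot> c = Option.bind (b \<odot> c) (\<lambda>y. a \<odot> y)"
      using sep_assoc[of a b c] assms(2) by simp
    moreover have "x' \<odot> c = Option.bind (b \<odot> c) (\<lambda>y. a' \<odot> y)"
      using sep_assoc[of a' b c] x' by simp
    ultimately show ?thesis
      using assms(1) by (cases "b \<odot> c") (simp_all add: footprint_eq_iff del: not_None_eq)
  qed
  then show thesis using that x' footprint_eq_iff by blast
qed

lemma footprint_eq_comp:
  fixes a a' b b' x :: "'s::sep_algebra"
  assumes "footprint a = footprint a'" "footprint b = footprint b'" "a \<odot> b = Some x"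
  obtains x' where "a' \<odot> b' = Some x'" "footprint x = footprint x'"
  by (metis assms footprint_eq_comp_right sep_comm)

lemma fp_comp_footprint:
  "fp_comp (footprint a) (footprint b) = map_option footprint (a \<odot> b)"
proof (cases "a \<odot> b")
  case None
  then have "\<not> (\<exists>\<sigma>1 \<sigma>2 \<sigma>. footprint a = footprint \<sigma>1 \<and> footprint b = footprint \<sigma>2 \<and>
                   \<sigma>1 \<odot> \<sigma>2 = Some \<sigma>)"
    by (metis footprint_eq_comp option.distinct(1))
  then show ?thesis using None unfolding fp_comp_def by simp
next
  case (Some x)
  have "(THE l. \<exists>\<sigma>1 \<sigma>2 \<sigma>. footprint a = footprint \<sigma>1 \<and> footprint b = footprint \<sigma>2 \<and>
           \<sigma>1 \<odot> \<sigma>2 = Some \<sigma> \<and> l = footprint \<sigma>) = footprint x"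
  proof (rule the_equality)
    fix l
    assume "\<exists>\<sigma>1 \<sigma>2 \<sigma>. footprint a = footprint \<sigma>1 \<and> footprint b = footprint \<sigma>2 \<and>
              \<sigma>1 \<odot> \<sigma>2 = Some \<sigma> \<and> l = footprint \<sigma>"
    then show "l = footprint x"
      by (metis Some footprint_eq_comp option.inject)
  qed (use Some in blast)
  then show ?thesis using Some unfolding fp_comp_def by auto
qed

lemma fp_diff_footprint:
  assumes "a \<odot> b = Some x"
  shows "fp_diff (footprint x) (footprint a) = Some (footprint b)"
proof -
  have "(THE l. \<exists>\<sigma>1 \<sigma>2 \<sigma>. footprint a = footprint \<sigma>1 \<and> footprint x = footprint \<sigma>2 \<and>
           \<sigma>1 \<odot> \<sigma> = Some \<sigma>2 \<and> l = footprint \<sigma>) = footprint b"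
  proof (rule the_equality)
    fix l
    assume "\<exists>\<sigma>1 \<sigma>2 \<sigma>. footprint a = footprint \<sigma>1 \<and> footprint x = footprint \<sigma>2 \<and>
              \<sigma>1 \<odot> \<sigma> = Some \<sigma>2 \<and> l = footprint \<sigma>"
    then show "l = footprint b"
      using assms footprint_cancel by metis
  qed (use assms in blast)
  then show ?thesis using assms unfolding fp_diff_def by auto
qed


section \<open>Histories\<close>

type_synonym thread = nat

datatype ('m, 's) iact = is_call: ICall 'm 's | is_ret: IRet 'm 's

type_synonym ('m, 's) history = "(thread \<times> ('m, 's) iact) list"

definition thread_proj :: "thread \<Rightarrow> (thread \<times> 'a) list \<Rightarrow> 'a list" where
  "thread_proj t xs = map snd (filter (\<lambda>x. fst x = t) xs)"

fun alternating :: "('m, 's) iact list \<Rightarrow> bool" where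
  "alternating [] \<longleftrightarrow> True"
| "alternating [ICall m \<sigma>] \<longleftrightarrow> True"
| "alternating (ICall m \<sigma> # IRet m' \<sigma>' # as) \<longleftrightarrow> m = m' \<and> alternating as"
| "alternating _ \<longleftrightarrow> False"

definition is_history :: "('m, 's) history \<Rightarrow> bool" where
  "is_history H \<longleftrightarrow> (\<forall>t. alternating (thread_proj t H))"

fun fp_act :: "('m, 's::footprint_sep_algebra) iact \<Rightarrow> 's set \<Rightarrow> 's set option" where
  "fp_act (ICall m \<sigma>) l = fp_comp l (footprint \<sigma>)"
| "fp_act (IRet m \<sigma>) l = fp_diff l (footprint \<sigma>)"

definition fp_hist :: "('m, 's::footprint_sep_algebra) history \<Rightarrow> 's set \<Rightarrow> 's set option" where
  "fp_hist H l = foldl (\<lambda>r \<psi>. Option.bind r (fp_act (snd \<psi>))) (Some l) H"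

definition balanced :: "'s::footprint_sep_algebra set \<Rightarrow> ('m, 's) history \<Rightarrow> bool" where
  "balanced l H \<longleftrightarrow> fp_hist H l \<noteq> None"

definition balanced_histories :: "('s::footprint_sep_algebra set \<times> ('m, 's) history) set" where
  "balanced_histories = {(l, H). l \<in> range footprint \<and> is_history H \<and> balanced l H}"

definition hist_le :: "('m, 's) history \<Rightarrow> ('m, 's) history \<Rightarrow> bool" where
  "hist_le H H' \<longleftrightarrow>
     (\<exists>\<rho>. bij_betw \<rho> {..<length H} {..<length H'} \<and>
        (\<forall>i<length H. H ! i = H' ! \<rho> i) \<and>
        (\<forall>i j. i < j \<and> j < length H \<and>
           (fst (H ! i) = fst (H ! j) \<or> is_ret (snd (H ! i)) \<and> is_call (snd (H ! j)))
           \<longrightarrow> \<rho> i < \<rho> j))"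

text \<open>A relation on balanced histories only, hence the two membership conditions.  They hold for
  all elements of interface sets, see the lemma \<open>interf_subset_balanced_histories\<close>.\<close>

definition bhist_le ::
  "'s::footprint_sep_algebra set \<times> ('m, 's) history \<Rightarrow> 's set \<times> ('m, 's) history \<Rightarrow> bool" where
  "bhist_le x y \<longleftrightarrow> x \<in> balanced_histories \<and> y \<in> balanced_histories \<and>
     fst y \<preceq> fst x \<and> hist_le (snd x) (snd y)"

definition bhists_le ::
  "('s::footprint_sep_algebra set \<times> ('m, 's) history) set \<Rightarrow>
   ('s set \<times> ('m, 's) history) set \<Rightarrow> bool" where
  "bhists_le X Y \<longleftrightarrow> (\<forall>x\<in>X. \<exists>y\<in>Y. bhist_le x y)"


section \<open>Primitive commands\<close>

text \<open>\<open>'a topped\<close> adds the error element \<open>\<top>\<close> to \<open>'a\<close>.\<close>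

datatype 'a topped = Top | Val 'a

type_synonym ('c, 's) transformer = "thread \<Rightarrow> 'c \<Rightarrow> 's \<Rightarrow> 's set topped"

definition footprint_preserving :: "('c, 's::sep_algebra) transformer \<Rightarrow> bool" where
  "footprint_preserving f \<longleftrightarrow>
     (\<forall>t c \<sigma> A \<sigma>'. f t c \<sigma> = Val A \<longrightarrow> \<sigma>' \<in> A \<longrightarrow> footprint \<sigma>' = footprint \<sigma>)"

definition strongly_local :: "('c, 's::sep_algebra) transformer \<Rightarrow> bool" where
  "strongly_local f \<longleftrightarrow>
     (\<forall>t c \<sigma>1 \<sigma>2 \<sigma> A. \<sigma>1 \<odot> \<sigma>2 = Some \<sigma> \<longrightarrow> f t c \<sigma>1 = Val A \<longrightarrow>
        f t c \<sigma> = Val (A \<star> {\<sigma>2}))"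


section \<open>Libraries and method specifications\<close>

datatype 'c com =
    Prim 'c
  | Seq "'c com" "'c com"
  | Choice "'c com" "'c com"
  | Star "'c com"

type_synonym ('m, 'c) library = "'m \<rightharpoonup> 'c com"

type_synonym 's ppred = "thread \<Rightarrow> 's set"

text \<open>\<^term>\<open>\<Gamma> m = Some (p, q)\<close> stands for the triple \<open>{p} m {q}\<close>.\<close>

type_synonym ('m, 's) mspec = "'m \<rightharpoonup> 's ppred \<times> 's ppred"

definition pre :: "('m, 's) mspec \<Rightarrow> 'm \<Rightarrow> 's ppred" where
  "pre \<Gamma> m = fst (the (\<Gamma> m))"

definition post :: "('m, 's) mspec \<Rightarrow> 'm \<Rightarrow> 's ppred" where
  "post \<Gamma> m = snd (the (\<Gamma> m))"

definition method_spec :: "('m, 's::sep_algebra) mspec \<Rightarrow> bool" where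
  "method_spec \<Gamma> \<longleftrightarrow> (\<forall>m\<in>dom \<Gamma>. \<forall>t. precise (pre \<Gamma> m t) \<and> precise (post \<Gamma> m t))"

definition extends :: "('m, 's::sep_algebra) mspec \<Rightarrow> ('m, 's) mspec \<Rightarrow> bool" where
  "extends \<Gamma>' \<Gamma> \<longleftrightarrow> dom \<Gamma>' = dom \<Gamma> \<and>
     (\<forall>m\<in>dom \<Gamma>. \<forall>t. pre \<Gamma>' m t \<subseteq> pre \<Gamma> m t \<star> UNIV \<and> post \<Gamma>' m t \<subseteq> post \<Gamma> m t \<star> UNIV)"


section \<open>Traces\<close>

datatype ('m, 'c) act = Do 'c | Call 'm | Ret 'm

type_synonym ('m, 'c) trace = "(thread \<times> ('m, 'c) act) list"

definition seq_traces :: "'a list set \<Rightarrow> 'a list set \<Rightarrow> 'a list set" where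
  "seq_traces A B = {xs @ ys | xs ys. xs \<in> A \<and> ys \<in> B}"

definition star_traces :: "'a list set \<Rightarrow> 'a list set" where
  "star_traces A = concat ` lists A"

primrec com_traces :: "thread \<Rightarrow> 'c com \<Rightarrow> ('m, 'c) trace set" where
  "com_traces t (Prim c) = {[(t, Do c)]}"
| "com_traces t (Seq C1 C2) = seq_traces (com_traces t C1) (com_traces t C2)"
| "com_traces t (Choice C1 C2) = com_traces t C1 \<union> com_traces t C2"
| "com_traces t (Star C) = star_traces (com_traces t C)"

definition thread_traces :: "('m, 'c) library \<Rightarrow> thread \<Rightarrow> ('m, 'c) trace set" where
  "thread_traces L t = star_traces
     {(t, Call m) # \<tau> @ [(t, Ret m)] | m C \<tau>. L m = Some C \<and> \<tau> \<in> com_traces t C}"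

primrec interleavings :: "'a list set list \<Rightarrow> 'a list set" where
  "interleavings [] = {[]}"
| "interleavings (T # Ts) = (\<Union>xs\<in>T. \<Union>ys\<in>interleavings Ts. shuffles xs ys)"

text \<open>A program with \<open>k\<close> threads uses the thread identifiers \<open>0, \<dots>, k - 1\<close>.\<close>

definition lib_traces :: "('m, 'c) library \<Rightarrow> ('m, 'c) trace set" where
  "lib_traces L = {\<tau>. \<exists>k\<ge>1. \<exists>\<tau>'\<in>interleavings (map (thread_traces L) [0..<k]). prefix \<tau> \<tau>'}"


section \<open>Library-local semantics\<close>

datatype ('m, 'c, 's) aact = ADo 'c | AIface "('m, 's) iact"

type_synonym ('m, 'c, 's) atrace = "(thread \<times> ('m, 'c, 's) aact) list"

fun step :: "('c, 's::sep_algebra) transformer \<Rightarrow> ('m, 's) mspec \<Rightarrow> thread \<times> ('m, 'c) act \<Rightarrow>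
    's \<Rightarrow> ('s \<times> (thread \<times> ('m, 'c, 's) aact)) set topped" where
  "step f \<Gamma> (t, Do c) \<sigma> =
     (case f t c \<sigma> of Top \<Rightarrow> Top | Val A \<Rightarrow> Val {(\<sigma>', (t, ADo c)) | \<sigma>'. \<sigma>' \<in> A})"
| "step f \<Gamma> (t, Call m) \<sigma> =
     Val {(\<sigma>', (t, AIface (ICall m \<sigma>p))) | \<sigma>' \<sigma>p. \<sigma>p \<in> pre \<Gamma> m t \<and> \<sigma> \<odot> \<sigma>p = Some \<sigma>'}"
| "step f \<Gamma> (t, Ret m) \<sigma> =
     (case pred_diff \<sigma> (post \<Gamma> m t) of
        None \<Rightarrow> Top
      | Some \<sigma>' \<Rightarrow> Val {(\<sigma>', (t, AIface (IRet m \<sigma>q))) | \<sigma>q.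
                         \<sigma>q \<in> post \<Gamma> m t \<and> \<sigma>q \<odot> \<sigma>' = Some \<sigma>})"

fun bind_topped :: "'a set topped \<Rightarrow> ('a \<Rightarrow> 'b set topped) \<Rightarrow> 'b set topped" where
  "bind_topped Top g = Top"
| "bind_topped (Val A) g =
     (if \<exists>x\<in>A. g x = Top then Top else Val {y. \<exists>x\<in>A. \<exists>B. g x = Val B \<and> y \<in> B})"

primrec eval_trace :: "('c, 's::sep_algebra) transformer \<Rightarrow> ('m, 's) mspec \<Rightarrow> ('m, 'c) trace \<Rightarrow>
    's \<Rightarrow> ('s \<times> ('m, 'c, 's) atrace) set topped" where
  "eval_trace f \<Gamma> [] \<sigma> = Val {(\<sigma>, [])}"
| "eval_trace f \<Gamma> (a # \<tau>) \<sigma> =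
     bind_topped (step f \<Gamma> a \<sigma>) (\<lambda>(\<sigma>', \<psi>).
       bind_topped (eval_trace f \<Gamma> \<tau> \<sigma>') (\<lambda>(\<sigma>'', \<mu>). Val {(\<sigma>'', \<psi> # \<mu>)}))"

definition lib_sem :: "('c, 's::sep_algebra) transformer \<Rightarrow> ('m, 'c) library \<Rightarrow>
    ('m, 's) mspec \<Rightarrow> 's \<Rightarrow> ('m, 'c, 's) atrace set topped" where
  "lib_sem f L \<Gamma> \<sigma> =
     (if \<exists>\<tau>\<in>lib_traces L. eval_trace f \<Gamma> \<tau> \<sigma> = Top then Top
      else Val {\<mu>. \<exists>\<tau>\<in>lib_traces L. \<exists>A \<sigma>'. eval_trace f \<Gamma> \<tau> \<sigma> = Val A \<and> (\<sigma>', \<mu>) \<in> A})"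

definition safe_for :: "('c, 's::sep_algebra) transformer \<Rightarrow> ('m, 'c) library \<Rightarrow>
    ('m, 's) mspec \<Rightarrow> 's set \<Rightarrow> bool" where
  "safe_for f L \<Gamma> I \<longleftrightarrow> (\<forall>\<sigma>\<in>I. lib_sem f L \<Gamma> \<sigma> \<noteq> Top)"

fun history :: "('m, 'c, 's) atrace \<Rightarrow> ('m, 's) history" where
  "history [] = []"
| "history ((t, ADo c) # \<mu>) = history \<mu>"
| "history ((t, AIface a) # \<mu>) = (t, a) # history \<mu>"

definition interf :: "('c, 's::sep_algebra) transformer \<Rightarrow> ('m, 'c) library \<Rightarrow>
    ('m, 's) mspec \<Rightarrow> 's set \<Rightarrow> ('s set \<times> ('m, 's) history) set" where
  "interf f L \<Gamma> I =
     {(footprint \<sigma>0, history \<mu>) | \<sigma>0 \<mu> A. \<sigma>0 \<in> I \<and> lib_sem f L \<Gamma> \<sigma>0 = Val A \<and> \<mu> \<in> A}"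

definition linearizes_to :: "('c, 's::footprint_sep_algebra) transformer \<Rightarrow> ('m, 's) mspec \<Rightarrow>
    ('m, 'c) library \<Rightarrow> 's set \<Rightarrow> ('m, 'c) library \<Rightarrow> 's set \<Rightarrow> bool" where
  "linearizes_to f \<Gamma> L1 I1 L2 I2 \<longleftrightarrow> bhists_le (interf f L1 \<Gamma> I1) (interf f L2 \<Gamma> I2)"


section \<open>Removing the part of a history described by a specification\<close>

fun strip_act :: "('m, 's::sep_algebra) mspec \<Rightarrow> thread \<times> ('m, 's) iact \<Rightarrow>
    (thread \<times> ('m, 's) iact) option" where
  "strip_act \<Gamma> (t, ICall m \<sigma>) =
     map_option (\<lambda>\<sigma>'. (t, ICall m \<sigma>')) (pred_diff \<sigma> (pre \<Gamma> m t))"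
| "strip_act \<Gamma> (t, IRet m \<sigma>) =
     map_option (\<lambda>\<sigma>'. (t, IRet m \<sigma>')) (pred_diff \<sigma> (post \<Gamma> m t))"

definition strip :: "('m, 's::sep_algebra) mspec \<Rightarrow> ('m, 's) history \<Rightarrow>
    ('m, 's) history option" where
  "strip \<Gamma> H = those (map (strip_act \<Gamma>) H)"

fun run_act :: "('m, 's::sep_algebra) iact \<Rightarrow> 's \<Rightarrow> 's topped" where
  "run_act (ICall m \<sigma>0) \<sigma> = (case \<sigma> \<odot> \<sigma>0 of None \<Rightarrow> Top | Some \<sigma>' \<Rightarrow> Val \<sigma>')"
| "run_act (IRet m \<sigma>0) \<sigma> = (case state_diff \<sigma> \<sigma>0 of None \<Rightarrow> Top | Some \<sigma>' \<Rightarrow> Val \<sigma>')"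

definition run_hist :: "('m, 's::sep_algebra) history \<Rightarrow> 's \<Rightarrow> 's topped" where
  "run_hist H \<sigma> =
     foldl (\<lambda>r \<psi>. case r of Top \<Rightarrow> Top | Val \<sigma>' \<Rightarrow> run_act (snd \<psi>) \<sigma>') (Val \<sigma>) H"


section \<open>Interfaces consist of balanced histories\<close>

lemma fp_hist_Nil [simp]: "fp_hist [] l = Some l"
  by (simp add: fp_hist_def)

lemma fp_hist_Cons:
  "fp_hist (\<psi> # H) l = Option.bind (fp_act (snd \<psi>) l) (fp_hist H)"
proof -
  have "foldl (\<lambda>r \<psi>. Option.bind r (fp_act (snd \<psi>))) None H = None"
    by (induction H) simp_all
  then show ?thesis
    by (cases "fp_act (snd \<psi>) l") (simp_all add: fp_hist_def)
qed

lemma eval_trace_ConsE: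
  assumes "eval_trace f \<Gamma> (a # \<tau>) \<sigma> = Val A" "(\<sigma>'', \<mu>) \<in> A"
  obtains B \<sigma>' \<psi> C \<mu>' where "step f \<Gamma> a \<sigma> = Val B" "(\<sigma>', \<psi>) \<in> B"
    "eval_trace f \<Gamma> \<tau> \<sigma>' = Val C" "(\<sigma>'', \<mu>') \<in> C" "\<mu> = \<psi> # \<mu>'"
proof -
  obtain B where B: "step f \<Gamma> a \<sigma> = Val B"
    using assms(1) by (cases "step f \<Gamma> a \<sigma>") auto
  let ?g = "\<lambda>(\<sigma>', \<psi>). bind_topped (eval_trace f \<Gamma> \<tau> \<sigma>') (\<lambda>(\<sigma>'', \<mu>). Val {(\<sigma>'', \<psi> # \<mu>)})"
  have "A = {y. \<exists>x\<in>B. \<exists>D. ?g x = Val D \<and> y \<in> D}"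
    using assms(1) B by (simp split: if_splits)
  then obtain \<sigma>' \<psi> D where D: "(\<sigma>', \<psi>) \<in> B"
      "bind_topped (eval_trace f \<Gamma> \<tau> \<sigma>') (\<lambda>(\<sigma>'', \<mu>). Val {(\<sigma>'', \<psi> # \<mu>)}) = Val D" "(\<sigma>'', \<mu>) \<in> D"
    using assms(2) by auto
  then obtain C where "eval_trace f \<Gamma> \<tau> \<sigma>' = Val C"
    by (cases "eval_trace f \<Gamma> \<tau> \<sigma>'") auto
  moreover from this D(2,3) obtain \<mu>' where "(\<sigma>'', \<mu>') \<in> C" "\<mu> = \<psi> # \<mu>'"
    by (auto split: if_splits)
  ultimately show thesis using that B D(1) by blast
qed

lemma fp_hist_eval_trace:
  fixes \<sigma> :: "'s::footprint_sep_algebra"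
  assumes "footprint_preserving f" "eval_trace f \<Gamma> \<tau> \<sigma> = Val A" "(\<sigma>', \<mu>) \<in> A"
  shows "fp_hist (history \<mu>) (footprint \<sigma>) = Some (footprint \<sigma>')"
  using assms(2,3)
proof (induction \<tau> arbitrary: \<sigma> A \<mu>)
  case (Cons a \<tau>)
  from Cons.prems obtain B \<sigma>1 \<psi> C \<mu>' where *: "step f \<Gamma> a \<sigma> = Val B" "(\<sigma>1, \<psi>) \<in> B"
    "eval_trace f \<Gamma> \<tau> \<sigma>1 = Val C" "(\<sigma>', \<mu>') \<in> C" "\<mu> = \<psi> # \<mu>'"
    by (rule eval_trace_ConsE)
  have IH: "fp_hist (history \<mu>') (footprint \<sigma>1) = Some (footprint \<sigma>')"
    using Cons.IH *(3,4) by blast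
  obtain t b where a: "a = (t, b)" by (cases a)
  show ?case
  proof (cases b)
    case (Do c)
    then obtain D where "f t c \<sigma> = Val D" "\<sigma>1 \<in> D" "\<psi> = (t, ADo c)"
      using *(1,2) a by (cases "f t c \<sigma>") auto
    then have "footprint \<sigma>1 = footprint \<sigma>"
      using assms(1) unfolding footprint_preserving_def by blast
    then show ?thesis using IH * \<open>\<psi> = (t, ADo c)\<close> by simp
  next
    case (Call m)
    then obtain \<sigma>p where "\<psi> = (t, AIface (ICall m \<sigma>p))" "\<sigma> \<odot> \<sigma>p = Some \<sigma>1"
      using *(1,2) a by auto
    then show ?thesis using IH * by (simp add: fp_hist_Cons fp_comp_footprint)
  next
    case (Ret m)
    then obtain \<sigma>q where "\<psi> = (t, AIface (IRet m \<sigma>q))" "\<sigma>q \<odot> \<sigma>1 = Some \<sigma>"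
      using *(1,2) a by (auto split: option.splits)
    then show ?thesis using IH * by (simp add: fp_hist_Cons fp_diff_footprint)
  qed
qed auto

fun skeleton :: "('m, 'c) trace \<Rightarrow> ('m, unit) history" where
  "skeleton [] = []"
| "skeleton ((t, Do c) # \<tau>) = skeleton \<tau>"
| "skeleton ((t, Call m) # \<tau>) = (t, ICall m ()) # skeleton \<tau>"
| "skeleton ((t, Ret m) # \<tau>) = (t, IRet m ()) # skeleton \<tau>"

abbreviation erase :: "('m, 's) iact \<Rightarrow> ('m, unit) iact" where
  "erase \<equiv> map_iact (\<lambda>m. m) (\<lambda>_. ())"

lemma skeleton_eval_trace:
  assumes "eval_trace f \<Gamma> \<tau> \<sigma> = Val A" "(\<sigma>', \<mu>) \<in> A"
  shows "skeleton \<tau> = map (\<lambda>(t, a). (t, erase a)) (history \<mu>)"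
  using assms
proof (induction \<tau> arbitrary: \<sigma> A \<mu>)
  case (Cons a \<tau>)
  from Cons.prems obtain B \<sigma>1 \<psi> C \<mu>' where *: "step f \<Gamma> a \<sigma> = Val B" "(\<sigma>1, \<psi>) \<in> B"
    "eval_trace f \<Gamma> \<tau> \<sigma>1 = Val C" "(\<sigma>', \<mu>') \<in> C" "\<mu> = \<psi> # \<mu>'"
    by (rule eval_trace_ConsE)
  have IH: "skeleton \<tau> = map (\<lambda>(t, a). (t, erase a)) (history \<mu>')"
    using Cons.IH *(3,4) by blast
  obtain t b where a: "a = (t, b)" by (cases a)
  show ?case using * IH a
    by (cases b) (auto split: topped.splits option.splits)
qed auto

lemma alternating_erase: "alternating (map erase as) = alternating as"
  by (induction as rule: alternating.induct) auto

lemma alternating_append_prefix: "alternating (as @ bs) \<Longrightarrow> alternating as"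
  by (induction as rule: alternating.induct) auto

lemma skeleton_append: "skeleton (xs @ ys) = skeleton xs @ skeleton ys"
  by (induction xs rule: skeleton.induct) auto

lemma thread_proj_skeleton:
  "thread_proj t (skeleton \<tau>) = map snd (skeleton (filter (\<lambda>x. fst x = t) \<tau>))"
  by (induction \<tau> rule: skeleton.induct) (auto simp: thread_proj_def)

lemma com_traces_Do: "\<tau> \<in> com_traces t C \<Longrightarrow> x \<in> set \<tau> \<Longrightarrow> \<exists>c. x = (t, Do c)"
  by (induction C arbitrary: \<tau>) (fastforce simp: seq_traces_def star_traces_def in_lists_conv_set)+

lemma skeleton_com_traces: "\<tau> \<in> com_traces t C \<Longrightarrow> skeleton \<tau> = []"
proof -
  have "(\<forall>x\<in>set \<tau>. \<exists>t c. x = (t, Do c)) \<Longrightarrow> skeleton \<tau> = []" for \<tau> :: "('a, 'b) trace"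
    by (induction \<tau>) auto
  then show "\<tau> \<in> com_traces t C \<Longrightarrow> skeleton \<tau> = []" using com_traces_Do by blast
qed

lemma thread_traces_fst: "\<tau> \<in> thread_traces L t \<Longrightarrow> x \<in> set \<tau> \<Longrightarrow> fst x = t"
  unfolding thread_traces_def star_traces_def
  by (fastforce simp: in_lists_conv_set dest: com_traces_Do)

lemma alternating_thread_traces:
  assumes "\<tau> \<in> thread_traces L t"
  shows "alternating (map snd (skeleton \<tau>))"
proof -
  obtain bs where bs: "\<tau> = concat bs"
    "\<forall>b\<in>set bs. \<exists>m C \<tau>. b = (t, Call m) # \<tau> @ [(t, Ret m)] \<and> L m = Some C \<and> \<tau> \<in> com_traces t C"
    using assms unfolding thread_traces_def star_traces_def by (auto simp: in_lists_conv_set)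
  from bs(2) have "alternating (map snd (skeleton (concat bs)))"
    by (induction bs) (auto simp: skeleton_append dest!: skeleton_com_traces)
  then show ?thesis using bs(1) by simp
qed

lemma filter_shuffles_Nil:
  assumes "zs \<in> shuffles xs ys" "\<forall>x\<in>set xs. \<not> P x"
  shows "filter P zs = filter P ys"
proof -
  have "filter P zs \<in> shuffles (filter P xs) (filter P ys)"
    using assms(1) filter_shuffles by blast
  then show ?thesis using assms(2) by simp
qed

lemma filter_interleavings:
  assumes "\<tau> \<in> interleavings (map (thread_traces L) ts)" "distinct ts"
  shows "filter (\<lambda>x. fst x = t) \<tau> \<in> insert [] (thread_traces L t)"
    and "t \<notin> set ts \<Longrightarrow> filter (\<lambda>x. fst x = t) \<tau> = []"
proof -
  have "filter (\<lambda>x. fst x = t) \<tau> \<in> insert [] (thread_traces L t) \<and>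
      (t \<notin> set ts \<longrightarrow> filter (\<lambda>x. fst x = t) \<tau> = [])"
    using assms
  proof (induction ts arbitrary: \<tau>)
    case (Cons u ts)
    then obtain xs ys where xy: "xs \<in> thread_traces L u"
      "ys \<in> interleavings (map (thread_traces L) ts)" "\<tau> \<in> shuffles xs ys"
      by auto
    have IH: "filter (\<lambda>x. fst x = t) ys \<in> insert [] (thread_traces L t)"
      "t \<notin> set ts \<Longrightarrow> filter (\<lambda>x. fst x = t) ys = []"
      using Cons.IH[OF xy(2)] Cons.prems by auto
    show ?case
    proof (cases "u = t")
      case True
      then have "filter (\<lambda>x. fst x = t) \<tau> = filter (\<lambda>x. fst x = t) xs"
        using filter_shuffles_Nil[of \<tau> ys xs "\<lambda>x. fst x = t"] xy(3) IH(2) Cons.prems(2)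
        by (simp add: shuffles_commutes filter_empty_conv)
      also have "\<dots> = xs" using thread_traces_fst[OF xy(1)] True by simp
      finally show ?thesis using xy(1) True by simp
    next
      case False
      then have "filter (\<lambda>x. fst x = t) \<tau> = filter (\<lambda>x. fst x = t) ys"
        using filter_shuffles_Nil[OF xy(3)] thread_traces_fst[OF xy(1)] by auto
      then show ?thesis using IH False by auto
    qed
  qed simp
  then show "filter (\<lambda>x. fst x = t) \<tau> \<in> insert [] (thread_traces L t)"
    and "t \<notin> set ts \<Longrightarrow> filter (\<lambda>x. fst x = t) \<tau> = []" by auto
qed

lemma is_history_skeleton:
  assumes "\<tau> \<in> lib_traces L"
  shows "is_history (skeleton \<tau>)"
  unfolding is_history_def
proof
  fix t
  obtain k \<tau>' where "\<tau> @ \<tau>' \<in> interleavings (map (thread_traces L) [0..<k])"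
    using assms unfolding lib_traces_def prefix_def by auto
  then have "filter (\<lambda>x. fst x = t) (\<tau> @ \<tau>') \<in> insert [] (thread_traces L t)"
    using filter_interleavings(1) distinct_upt by blast
  then have "alternating (thread_proj t (skeleton (\<tau> @ \<tau>')))"
    unfolding thread_proj_skeleton using alternating_thread_traces by fastforce
  then show "alternating (thread_proj t (skeleton \<tau>))"
    using alternating_append_prefix by (auto simp: skeleton_append thread_proj_def)
qed

lemma interf_subset_balanced_histories:
  assumes "footprint_preserving f"
  shows "interf f L \<Gamma> I \<subseteq> balanced_histories"
proof
  fix x assume "x \<in> interf f L \<Gamma> I"
  then obtain \<sigma>0 \<mu> \<tau> A \<sigma>' where x: "x = (footprint \<sigma>0, history \<mu>)" "\<tau> \<in> lib_traces L"
      "eval_trace f \<Gamma> \<tau> \<sigma>0 = Val A" "(\<sigma>', \<mu>) \<in> A"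
    unfolding interf_def lib_sem_def by (auto split: if_splits)
  have "alternating (thread_proj t (history \<mu>))" for t
  proof -
    have "thread_proj t (skeleton \<tau>) = map erase (thread_proj t (history \<mu>))"
      unfolding skeleton_eval_trace[OF x(3,4)] thread_proj_def
      by (simp add: filter_map o_def case_prod_beta)
    then show ?thesis
      using is_history_skeleton[OF x(2)] alternating_erase unfolding is_history_def by metis
  qed
  then show "x \<in> balanced_histories"
    using fp_hist_eval_trace[OF assms x(3,4)] x(1)
    by (auto simp: balanced_histories_def is_history_def balanced_def)
qed

end

theory Submission
  imports Defs
begin

text \<open>
  An execution of the first library under the extended specification \<open>\<Gamma>'\<close> splits by strong locality
  into an execution under \<open>\<Gamma>\<close> and a run of the extra state that the interface transfers.  The
  former is linearized by an execution of the second library whose history is a rearrangement in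
  which, relative to each other, returns move earlier and calls move later.  We replay this execution
  under \<open>\<Gamma>'\<close>, adding the original extra states to the calls.  Two points need an argument: the calls
  must be defined, and the returns, which exist by safety, must transfer the original states.

  Both follow by advancing the original execution alongside the replay.  At any time the states of the
  two differ, up to footprints of the library part, exactly by the states transferred by the pending
  actions: calls performed only by the original and returns performed only by the replay.
  The replay always lives inside a state compatible with the original one, which makes the calls
  defined; when the original execution reaches a pending return, the state transferred by it and the
  one transferred by the replay are substates of the same state, so they agree by precision.
  The replay's state under \<open>\<Gamma>'\<close> need not contain its library state under \<open>\<Gamma>\<close>, since a return may a
  priori take resources of the library; hence primitive commands are matched by applying strong
  locality twice, from either state up to a common larger one.
\<close>

section \<open>The option monoid of a separation algebra\<close>

text \<open>With \<open>None\<close> absorbing, partial composition becomes a total commutative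
  monoid: finite products make sense, and definedness is carried through rearrangements.\<close>

definition ocomp :: "'s::sep_algebra option \<Rightarrow> 's option \<Rightarrow> 's option"  (infixl "\<oplus>" 70) where
  "A \<oplus> B = Option.bind A (\<lambda>a. Option.bind B (\<lambda>b. a \<odot> b))"

lemma ocomp_simps [simp]: "Some a \<oplus> Some b = a \<odot> b" "None \<oplus> B = None" "A \<oplus> None = None"
  by (auto simp: ocomp_def split: Option.bind_split)

lemma ocomp_assoc: "A \<oplus> B \<oplus> C = A \<oplus> (B \<oplus> C)"
proof (cases A; cases B; cases C)
  fix a b c assume "A = Some a" "B = Some b" "C = Some c"
  moreover have "x \<oplus> Some c = Option.bind x (\<lambda>y. y \<odot> c)"
    "Some a \<oplus> x = Option.bind x (\<lambda>y. a \<odot> y)" for x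
    by (auto simp: ocomp_def split: Option.bind_split)
  ultimately show ?thesis using sep_assoc[of a b c] by simp
qed auto

lemma ocomp_comm: "A \<oplus> B = B \<oplus> A"
  by (cases A; cases B) (auto simp: sep_comm)

global_interpretation sep_prod: comm_monoid_set ocomp "Some sep_unit"
  defines oprod = sep_prod.F
proof
  show "A \<oplus> Some sep_unit = A" for A :: "'s::sep_algebra option"
    by (cases A) (simp_all add: sep_unit)
qed (rule ocomp_assoc ocomp_comm)+

lemmas ocomp_ac = ocomp_assoc ocomp_comm sep_prod.left_commute

lemma ocomp_eq_Some_iff:
  "A \<oplus> B = Some x \<longleftrightarrow> (\<exists>a b. A = Some a \<and> B = Some b \<and> a \<odot> b = Some x)"
  by (cases A; cases B) auto

lemma ocomp_cancel:
  assumes "Some a \<oplus> B = Some a \<oplus> C" "Some a \<oplus> B \<noteq> None"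
  shows "B = C"
  using assms by (cases B; cases C) (auto dest: sep_cancel)

section \<open>Footprints of possibly undefined states\<close>

definition ofp :: "'s::sep_algebra option \<Rightarrow> 's set option" where
  "ofp A = map_option footprint A"

lemma ofp_simps [simp]: "ofp (Some a) = Some (footprint a)" "ofp None = None"
  by (simp_all add: ofp_def)

lemma ofp_None_iff [simp]: "ofp A = None \<longleftrightarrow> A = None"
  by (simp add: ofp_def)

text \<open>Composability depends only on the footprint, so this congruence preserves undefinedness
  as well.\<close>

lemma ofp_ocomp:
  assumes "ofp A = ofp B"
  shows "ofp (A \<oplus> C) = ofp (B \<oplus> C)"
proof (cases "A \<oplus> C")
  case None
  show ?thesis
  proof (cases "B \<oplus> C")
    case (Some x)
    then obtain b c where bc: "B = Some b" "C = Some c" "b \<odot> c = Some x"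
      by (auto simp: ocomp_eq_Some_iff)
    then obtain a where a: "A = Some a" "footprint b = footprint a"
      using assms by (cases A) auto
    obtain x' where "a \<odot> c = Some x'"
      using footprint_eq_comp_right[OF a(2) bc(3)] by blast
    then show ?thesis using None a bc by simp
  qed (use None in simp)
next
  case (Some x)
  then obtain a c where ac: "A = Some a" "C = Some c" "a \<odot> c = Some x"
    by (auto simp: ocomp_eq_Some_iff)
  then obtain b where b: "B = Some b" "footprint a = footprint b"
    using assms by (cases B) auto
  obtain x' where "b \<odot> c = Some x'" "footprint x = footprint x'"
    using footprint_eq_comp_right[OF b(2) ac(3)] by blast
  then show ?thesis using Some b ac by simp
qed

lemma ofp_cancel:
  fixes a :: "'s::footprint_sep_algebra"
  assumes "ofp (Some a \<oplus> B) = ofp (Some a \<oplus> C)" "Some a \<oplus> B \<noteq> None"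
  shows "ofp B = ofp C"
proof -
  have "Some a \<oplus> C \<noteq> None" using assms by (metis ofp_None_iff)
  then obtain b c x x' where *: "B = Some b" "C = Some c" "a \<odot> b = Some x" "a \<odot> c = Some x'"
    using assms(2) by (cases B; cases C) auto
  then have "footprint x = footprint x'" using assms(1) by simp
  then show ?thesis using footprint_cancel[OF *(3,4)] * by simp
qed

section \<open>Precision and differences of states\<close>

lemma precise_ocomp:
  assumes "precise r" "a \<in> r" "b \<in> r" "Some a \<oplus> A = Some b \<oplus> B" "Some a \<oplus> A \<noteq> None"
  shows "a = b"
proof -
  obtain x where x: "Some a \<oplus> A = Some x" using assms(5) by blast
  then have "Some b \<oplus> B = Some x" using assms(4) by simp
  with x show ?thesis using assms(1-3) unfolding precise_def ocomp_eq_Some_iff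
    by (metis option.inject)
qed

text \<open>Precision fixes the substate in \<open>r\<close> and cancellation then fixes the
  remainder, so the description in \<open>pred_diff\<close> is unique.\<close>

lemma pred_diff_eq_Some:
  assumes "precise r"
  shows "pred_diff x r = Some d \<longleftrightarrow> (\<exists>a\<in>r. a \<odot> d = Some x)"
proof -
  have uniq: "d = d'" if "a \<in> r" "a \<odot> d = Some x" "a' \<in> r" "a' \<odot> d' = Some x" for a a' d d'
    using that assms sep_cancel unfolding precise_def by metis
  then have "a \<in> r \<Longrightarrow> a \<odot> d = Some x \<Longrightarrow> (THE d. \<exists>a\<in>r. a \<odot> d = Some x) = d" for a d
    by (intro the_equality) blast+
  then show ?thesis unfolding pred_diff_def by (auto split: if_splits)
qed

lemma state_diff_eq_Some: "state_diff x a = Some d \<longleftrightarrow> d \<odot> a = Some x"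
proof -
  have "d \<odot> a = Some x \<Longrightarrow> (THE d. d \<odot> a = Some x) = d" for d
    by (rule the_equality) (metis sep_cancel sep_comm)+
  then show ?thesis unfolding state_diff_def by (auto split: if_splits)
qed


section \<open>Evaluation of traces\<close>

text \<open>Without \<open>Top\<close> no branch fails, so every outcome of the first step can be
  continued. This allows an execution to be built step by step.\<close>

lemma eval_trace_Cons_Val:
  assumes "eval_trace f \<Gamma> (a # \<tau>) \<sigma> = Val A"
  obtains B where "step f \<Gamma> a \<sigma> = Val B"
    "\<And>\<sigma>' \<psi>. (\<sigma>', \<psi>) \<in> B \<Longrightarrow>
       \<exists>C. eval_trace f \<Gamma> \<tau> \<sigma>' = Val C \<and> (\<forall>\<sigma>'' \<mu>. (\<sigma>'', \<mu>) \<in> C \<longrightarrow> (\<sigma>'', \<psi> # \<mu>) \<in> A)"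
proof -
  obtain B where B: "step f \<Gamma> a \<sigma> = Val B"
    using assms by (cases "step f \<Gamma> a \<sigma>") auto
  let ?g = "\<lambda>(\<sigma>', \<psi>). bind_topped (eval_trace f \<Gamma> \<tau> \<sigma>') (\<lambda>(\<sigma>'', \<mu>). Val {(\<sigma>'', \<psi> # \<mu>)})"
  have A: "A = {y. \<exists>x\<in>B. \<exists>D. ?g x = Val D \<and> y \<in> D}" and no_Top: "\<forall>x\<in>B. ?g x \<noteq> Top"
    using assms B by (simp_all split: if_splits)
  show thesis
  proof (rule that[OF B])
    fix \<sigma>' \<psi> assume in_B: "(\<sigma>', \<psi>) \<in> B"
    obtain C where C: "eval_trace f \<Gamma> \<tau> \<sigma>' = Val C"
      using no_Top in_B by (cases "eval_trace f \<Gamma> \<tau> \<sigma>'") auto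
    have "?g (\<sigma>', \<psi>) = Val ((\<lambda>(\<sigma>'', \<mu>). (\<sigma>'', \<psi> # \<mu>)) ` C)"
      using C by (auto simp: case_prod_unfold)
    then have "(\<sigma>'', \<psi> # \<mu>) \<in> A" if "(\<sigma>'', \<mu>) \<in> C" for \<sigma>'' \<mu>
      unfolding A using in_B that by (intro CollectI bexI[OF _ in_B]) force
    with C show "\<exists>C. eval_trace f \<Gamma> \<tau> \<sigma>' = Val C \<and>
        (\<forall>\<sigma>'' \<mu>. (\<sigma>'', \<mu>) \<in> C \<longrightarrow> (\<sigma>'', \<psi> # \<mu>) \<in> A)"
      by blast
  qed
qed

text \<open>Bodies yield only \<open>Do\<close> actions, so each interface action delimits a block
  of a method of \<open>L\<close>. This matters because \<open>pre\<close> and \<open>post\<close>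
  are meaningful only on the domain of a specification.\<close>

lemma lib_traces_methods:
  assumes "\<tau> \<in> lib_traces L" "(t, Call m) \<in> set \<tau> \<or> (t, Ret m) \<in> set \<tau>"
  shows "m \<in> dom L"
proof -
  obtain k \<tau>' where \<tau>': "\<tau> @ \<tau>' \<in> interleavings (map (thread_traces L) [0..<k])"
    using assms(1) unfolding lib_traces_def prefix_def by auto
  define \<tau>t where "\<tau>t = filter (\<lambda>x. fst x = t) (\<tau> @ \<tau>')"
  have "\<tau>t \<in> insert [] (thread_traces L t)"
    using filter_interleavings(1)[OF \<tau>'] unfolding \<tau>t_def by simp
  moreover have in_\<tau>t: "(t, Call m) \<in> set \<tau>t \<or> (t, Ret m) \<in> set \<tau>t"
    using assms(2) unfolding \<tau>t_def by auto
  ultimately have "\<tau>t \<in> thread_traces L t" by auto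
  then obtain bs where bs: "\<tau>t = concat bs"
    "\<forall>b\<in>set bs. \<exists>m C \<tau>. b = (t, Call m) # \<tau> @ [(t, Ret m)] \<and> L m = Some C \<and> \<tau> \<in> com_traces t C"
    unfolding thread_traces_def star_traces_def by (auto simp: in_lists_conv_set)
  from in_\<tau>t bs obtain m' C \<rho> where "L m' = Some C" "\<rho> \<in> com_traces t C"
    "(t, Call m) \<in> set ((t, Call m') # \<rho> @ [(t, Ret m')]) \<or>
     (t, Ret m) \<in> set ((t, Call m') # \<rho> @ [(t, Ret m')])"
    by fastforce
  moreover from this(2) have "(t, Call m) \<notin> set \<rho>" "(t, Ret m) \<notin> set \<rho>"
    by (auto dest: com_traces_Do)
  ultimately show ?thesis by auto
qed


section \<open>Splitting an execution into a library part and an extra part\<close>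

text \<open>Only footprints of the library states are tracked, because primitive commands change these
  states between two interface actions.\<close>

inductive split_step :: "('m, 's::sep_algebra) mspec \<Rightarrow> thread \<times> ('m, 's) iact \<Rightarrow>
    thread \<times> ('m, 's) iact \<Rightarrow> 's \<Rightarrow> 's \<Rightarrow> 's \<Rightarrow> 's \<Rightarrow> bool" for \<Gamma>' where
  Call: "split_step \<Gamma>' (t, ICall m h) (t, ICall m g) l e l' e'"
    if "m \<in> dom \<Gamma>'" "h \<in> pre \<Gamma>' m t" "g \<odot> x = Some h" "l \<odot> g = Some l1"
      "footprint l1 = footprint l'" "e \<odot> x = Some e'"
| Ret: "split_step \<Gamma>' (t, IRet m h) (t, IRet m g) l e l' e'"
    if "m \<in> dom \<Gamma>'" "h \<in> post \<Gamma>' m t" "g \<odot> x = Some h" "g \<odot> l1 = Some l"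
      "footprint l1 = footprint l'" "x \<odot> e' = Some e"

text \<open>\<open>ls i\<close> and \<open>es i\<close> are the states after \<open>i\<close>
  interface actions. Even \<open>ls 0\<close> is tied to \<open>l\<close> only by its footprint,
  which absorbs primitive commands before the first action.\<close>

definition split_run :: "('m, 's::sep_algebra) mspec \<Rightarrow> ('m, 's) history \<Rightarrow> ('m, 's) history \<Rightarrow>
    's \<Rightarrow> 's \<Rightarrow> (nat \<Rightarrow> 's) \<Rightarrow> (nat \<Rightarrow> 's) \<Rightarrow> bool" where
  "split_run \<Gamma>' H G l e ls es \<longleftrightarrow> length G = length H \<and> footprint (ls 0) = footprint l \<and> es 0 = e \<and>
     (\<forall>i<length H. split_step \<Gamma>' (H ! i) (G ! i) (ls i) (es i) (ls (Suc i)) (es (Suc i))) \<and>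
     (\<forall>i\<le>length H. ls i \<odot> es i \<noteq> None)"

lemma split_run_footprint:
  "split_run \<Gamma>' H G l e ls es \<Longrightarrow> footprint l = footprint l' \<Longrightarrow> split_run \<Gamma>' H G l' e ls es"
  by (simp add: split_run_def)

lemma split_run_Cons:
  assumes "split_step \<Gamma>' \<psi> \<phi> l e l' e'" "split_run \<Gamma>' H G l' e' ls es" "l \<odot> e \<noteq> None"
  shows "split_run \<Gamma>' (\<psi> # H) (\<phi> # G) l e (case_nat l ls) (case_nat e es)"
proof -
  \<comment> \<open>\<open>split_step\<close> sees the successor library state only through its
    footprint, so \<open>l'\<close> can be exchanged for \<open>ls 0\<close>.\<close>
  have "split_step \<Gamma>' \<psi> \<phi> l e (ls 0) (es 0)"
    using assms(1,2) by (cases rule: split_step.cases) (auto simp: split_run_def intro: split_step.intros)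
  then have "split_step \<Gamma>' ((\<psi> # H) ! i) ((\<phi> # G) ! i) (case_nat l ls i) (case_nat e es i)
      (case_nat l ls (Suc i)) (case_nat e es (Suc i))" if "i < length (\<psi> # H)" for i
    using that assms(2) by (cases i) (auto simp: split_run_def)
  moreover have "case_nat l ls i \<odot> case_nat e es i \<noteq> None" if "i \<le> length (\<psi> # H)" for i
    using that assms(2,3) by (cases i) (auto simp: split_run_def)
  ultimately show ?thesis using assms(2) by (simp add: split_run_def)
qed

lemma run_hist_Cons:
  "run_hist (\<psi> # H) \<sigma> = (case run_act (snd \<psi>) \<sigma> of Top \<Rightarrow> Top | Val \<sigma>' \<Rightarrow> run_hist H \<sigma>')"
proof -
  have "foldl (\<lambda>r \<psi>. case r of Top \<Rightarrow> Top | Val \<sigma>' \<Rightarrow> run_act (snd \<psi>) \<sigma>') Top H = Top"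
    by (induction H) simp_all
  then show ?thesis by (simp add: run_hist_def split: topped.split)
qed

lemma strip_Cons_eq_Some:
  "strip \<Gamma> (\<psi> # H) = Some X \<longleftrightarrow>
     (\<exists>x X'. strip_act \<Gamma> \<psi> = Some x \<and> strip \<Gamma> H = Some X' \<and> X = x # X')"
  by (auto simp: strip_def split: option.splits)

text \<open>The same trace is evaluated under both specifications. Strong locality lets primitive
  commands act on the library part with frame \<open>e\<close>; calls add their extra payload to
  \<open>e\<close> and returns remove it, which \<open>run_hist\<close> guarantees to be
  possible.\<close>

lemma split_trace:
  fixes f :: "('c, 's::sep_algebra) transformer" and \<tau> :: "('m, 'c) trace"
  assumes "footprint_preserving f" "strongly_local f" "method_spec \<Gamma>" "method_spec \<Gamma>'"
    and "eval_trace f \<Gamma>' \<tau> \<sigma> = Val A" "(\<sigma>', \<mu>) \<in> A" "eval_trace f \<Gamma> \<tau> l = Val B" "l \<odot> e = Some \<sigma>"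
    and "strip \<Gamma> (history \<mu>) = Some X" "run_hist X e \<noteq> Top"
    and "\<And>t m. (t, Call m) \<in> set \<tau> \<or> (t, Ret m) \<in> set \<tau> \<Longrightarrow> m \<in> dom \<Gamma> \<and> m \<in> dom \<Gamma>'"
  shows "\<exists>l' \<nu> ls es. (l', \<nu>) \<in> B \<and> split_run \<Gamma>' (history \<mu>) (history \<nu>) l e ls es"
  using assms(5-)
proof (induction \<tau> arbitrary: \<sigma> A \<mu> l e B X)
  case Nil
  then have "split_run \<Gamma>' (history \<mu>) (history []) l e (\<lambda>_. l) (\<lambda>_. e)"
    by (auto simp: split_run_def)
  with Nil show ?case by auto
next
  case (Cons a \<tau>)
  obtain A1 \<sigma>1 \<psi> C \<mu>' where A1: "step f \<Gamma>' a \<sigma> = Val A1" "(\<sigma>1, \<psi>) \<in> A1"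
    "eval_trace f \<Gamma>' \<tau> \<sigma>1 = Val C" "(\<sigma>', \<mu>') \<in> C" "\<mu> = \<psi> # \<mu>'"
    using eval_trace_ConsE[OF Cons.prems(1,2)] .
  obtain B1 where B1: "step f \<Gamma> a l = Val B1" "\<And>l1 \<phi>. (l1, \<phi>) \<in> B1 \<Longrightarrow>
      \<exists>D. eval_trace f \<Gamma> \<tau> l1 = Val D \<and> (\<forall>l' \<nu>. (l', \<nu>) \<in> D \<longrightarrow> (l', \<phi> # \<nu>) \<in> B)"
    using eval_trace_Cons_Val[OF Cons.prems(3)] by metis
  have split: "Some l \<oplus> Some e = Some \<sigma>" using Cons.prems(4) by simp
  have IH: "\<exists>l' \<nu> ls es. (l', \<phi> # \<nu>) \<in> B \<and> split_run \<Gamma>' (history \<mu>') (history \<nu>) l1 e1 ls es"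
    if prems: "(l1, \<phi>) \<in> B1" "l1 \<odot> e1 = Some \<sigma>1" "strip \<Gamma> (history \<mu>') = Some X'" "run_hist X' e1 \<noteq> Top"
    for l1 \<phi> e1 X'
  proof -
    obtain D where D: "eval_trace f \<Gamma> \<tau> l1 = Val D" "\<forall>l' \<nu>. (l', \<nu>) \<in> D \<longrightarrow> (l', \<phi> # \<nu>) \<in> B"
      using B1(2) prems(1) by blast
    show ?thesis using Cons.IH[OF A1(3,4) D(1) prems(2-4)] D(2) Cons.prems(7) by fastforce
  qed
  obtain t b where a: "a = (t, b)" by (cases a)
  show ?case
  proof (cases b)
    case (Do c)
    obtain D where D: "f t c l = Val D" "B1 = {(l1, (t, ADo c)) | l1. l1 \<in> D}"
      using B1(1) a Do by (cases "f t c l") auto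
    have "f t c \<sigma> = Val (D \<star> {e})"
      using assms(2) D(1) Cons.prems(4) unfolding strongly_local_def by blast
    then obtain l1 where l1: "l1 \<in> D" "l1 \<odot> e = Some \<sigma>1" "\<psi> = (t, ADo c)"
      using A1(1,2) a Do by (auto simp: pred_comp_def)
    have "footprint l1 = footprint l"
      using assms(1) D(1) l1(1) unfolding footprint_preserving_def by blast
    moreover have "\<exists>l' \<nu> ls es. (l', (t, ADo c) # \<nu>) \<in> B \<and>
        split_run \<Gamma>' (history \<mu>') (history \<nu>) l1 e ls es"
      using IH[of l1 "(t, ADo c)" e] l1 D(2) Cons.prems(5,6) A1(5) by auto
    ultimately obtain l' \<nu> ls es where "(l', (t, ADo c) # \<nu>) \<in> B"
        "split_run \<Gamma>' (history \<mu>) (history ((t, ADo c) # \<nu>)) l e ls es"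
      using split_run_footprint A1(5) l1(3) by fastforce
    then show ?thesis by blast
  next
    case (Call m)
    obtain h where h: "\<psi> = (t, AIface (ICall m h))" "h \<in> pre \<Gamma>' m t" "\<sigma> \<odot> h = Some \<sigma>1"
      using A1(1,2) a Call by auto
    have m: "m \<in> dom \<Gamma>" "m \<in> dom \<Gamma>'" using Cons.prems(7) a Call by auto
    obtain x X' where x: "pred_diff h (pre \<Gamma> m t) = Some x" "X = (t, ICall m x) # X'"
      "strip \<Gamma> (history \<mu>') = Some X'"
      using Cons.prems(5) A1(5) h(1) by (auto simp: strip_Cons_eq_Some)
    obtain g where g: "g \<in> pre \<Gamma> m t" "g \<odot> x = Some h"
      using x(1) assms(3) m(1) unfolding method_spec_def by (auto simp: pred_diff_eq_Some)
    obtain e1 where e1: "e \<odot> x = Some e1" "run_hist X' e1 \<noteq> Top"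
      using Cons.prems(6) x(2) by (auto simp: run_hist_Cons split: option.splits)
    \<comment> \<open>The regrouped product is defined, hence so is the factor
      \<open>l \<odot> g\<close> needed for the call under \<open>\<Gamma>\<close>.\<close>
    have "(Some l \<oplus> Some g) \<oplus> (Some e \<oplus> Some x) = (Some l \<oplus> Some e) \<oplus> (Some g \<oplus> Some x)"
      by (simp only: ocomp_ac)
    also have "\<dots> = Some \<sigma>1" using split g(2) h(3) by simp
    finally obtain l1 where l1: "l \<odot> g = Some l1" "l1 \<odot> e1 = Some \<sigma>1"
      using e1(1) by (auto simp: ocomp_eq_Some_iff)
    have "(l1, (t, AIface (ICall m g))) \<in> B1"
      using B1(1) a Call g(1) l1(1) by auto
    from IH[OF this l1(2) x(3) e1(2)] obtain l' \<nu> ls es where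
      in_B: "(l', (t, AIface (ICall m g)) # \<nu>) \<in> B"
      and run: "split_run \<Gamma>' (history \<mu>') (history \<nu>) l1 e1 ls es"
      by blast
    have "split_step \<Gamma>' (t, ICall m h) (t, ICall m g) l e l1 e1"
      using split_step.Call[OF m(2) h(2) g(2) l1(1) refl e1(1)] .
    from split_run_Cons[OF this run]
    have "split_run \<Gamma>' (history \<mu>) (history ((t, AIface (ICall m g)) # \<nu>)) l e
        (case_nat l ls) (case_nat e es)"
      using A1(5) h(1) Cons.prems(4) by simp
    then show ?thesis using in_B by blast
  next
    case (Ret m)
    obtain h where h: "\<psi> = (t, AIface (IRet m h))" "h \<in> post \<Gamma>' m t" "h \<odot> \<sigma>1 = Some \<sigma>"
      using A1(1,2) a Ret by (auto split: option.splits)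
    have m: "m \<in> dom \<Gamma>" "m \<in> dom \<Gamma>'" using Cons.prems(7) a Ret by auto
    then have prec: "precise (post \<Gamma> m t)" using assms(3) unfolding method_spec_def by blast
    obtain x X' where x: "pred_diff h (post \<Gamma> m t) = Some x" "X = (t, IRet m x) # X'"
      "strip \<Gamma> (history \<mu>') = Some X'"
      using Cons.prems(5) A1(5) h(1) by (auto simp: strip_Cons_eq_Some)
    obtain g where g: "g \<in> post \<Gamma> m t" "g \<odot> x = Some h"
      using x(1) prec by (auto simp: pred_diff_eq_Some)
    obtain e1 where e1: "x \<odot> e1 = Some e" "run_hist X' e1 \<noteq> Top"
      using Cons.prems(6) x(2)
      by (auto simp: run_hist_Cons state_diff_eq_Some sep_comm split: option.splits)
    obtain l1 where l1: "pred_diff l (post \<Gamma> m t) = Some l1"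
      using B1(1) a Ret by (auto split: option.splits)
    then obtain q where q: "q \<in> post \<Gamma> m t" "q \<odot> l1 = Some l"
      using prec by (auto simp: pred_diff_eq_Some)
    \<comment> \<open>The library returns \<open>q\<close>, a priori different from the part
      \<open>g\<close> of \<open>h\<close>; both are factors of \<open>\<sigma>\<close> in one
      precise predicate.\<close>
    have "Some g \<oplus> (Some x \<oplus> Some \<sigma>1) = Some \<sigma>"
      using g(2) h(3) ocomp_assoc[of "Some g" "Some x" "Some \<sigma>1"] by simp
    moreover have "Some q \<oplus> (Some l1 \<oplus> Some e) = Some \<sigma>"
      using q(2) split ocomp_assoc[of "Some q" "Some l1" "Some e"] by simp
    ultimately have "g = q" using precise_ocomp[OF prec g(1) q(1)] by (metis option.distinct(1))
    with q have l1_g: "g \<odot> l1 = Some l" by simp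
    have "Some h \<oplus> (Some l1 \<oplus> Some e1) = (Some g \<oplus> Some x) \<oplus> (Some l1 \<oplus> Some e1)"
      using g(2) by simp
    also have "\<dots> = (Some g \<oplus> Some l1) \<oplus> (Some x \<oplus> Some e1)" by (simp only: ocomp_ac)
    also have "\<dots> = Some h \<oplus> Some \<sigma>1" using l1_g e1(1) split h(3) by simp
    finally have l1_e1: "l1 \<odot> e1 = Some \<sigma>1"
      using ocomp_cancel[of h "Some l1 \<oplus> Some e1" "Some \<sigma>1"] h(3) by simp
    have "(l1, (t, AIface (IRet m g))) \<in> B1"
      using B1(1) a Ret l1 g(1) l1_g by auto
    from IH[OF this l1_e1 x(3) e1(2)] obtain l' \<nu> ls es where
      in_B: "(l', (t, AIface (IRet m g)) # \<nu>) \<in> B"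
      and run: "split_run \<Gamma>' (history \<mu>') (history \<nu>) l1 e1 ls es"
      by blast
    have "split_step \<Gamma>' (t, IRet m h) (t, IRet m g) l e l1 e1"
      using split_step.Ret[OF m(2) h(2) g(2) l1_g refl e1(1)] .
    from split_run_Cons[OF this run]
    have "split_run \<Gamma>' (history \<mu>) (history ((t, AIface (IRet m g)) # \<nu>)) l e
        (case_nat l ls) (case_nat e es)"
      using A1(5) h(1) Cons.prems(4) by simp
    then show ?thesis using in_B by blast
  qed
qed


section \<open>Replaying a rearranged history\<close>

fun payload :: "('m, 's) iact \<Rightarrow> 's" where
  "payload (ICall m \<sigma>) = \<sigma>"
| "payload (IRet m \<sigma>) = \<sigma>"

text \<open>Interface actions are identified with their positions in \<open>H\<close>.  The state \<open>\<kappa>\<close> accounts for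
  the initial footprint of the replaying library being smaller than that of the original one.\<close>

locale split_execution =
  fixes f :: "('c, 's::footprint_sep_algebra) transformer"
    and \<Gamma> \<Gamma>' :: "('m, 's) mspec"
    and H G :: "('m, 's) history"
    and ls es :: "nat \<Rightarrow> 's"
    and \<kappa> :: 's
  assumes footprint_preserving: "footprint_preserving f"
    and strongly_local: "strongly_local f"
    and method_spec: "method_spec \<Gamma>'"
    and split_steps: "\<And>i. i < length H \<Longrightarrow>
      split_step \<Gamma>' (H ! i) (G ! i) (ls i) (es i) (ls (Suc i)) (es (Suc i))"
    and compatible: "\<And>i. i \<le> length H \<Longrightarrow> ls i \<odot> es i \<noteq> None"
begin

section \<open>Pending actions and the coupling invariant\<close>

abbreviation ret :: "nat \<Rightarrow> bool" where
  "ret i \<equiv> is_ret (snd (H ! i))"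

definition g :: "nat \<Rightarrow> 's" where
  "g i = payload (snd (G ! i))"

definition h :: "nat \<Rightarrow> 's" where
  "h i = payload (snd (H ! i))"

text \<open>The two other mismatches, a call in \<open>K\<close> at or beyond \<open>n\<close> and a
  return below \<open>n\<close> outside \<open>K\<close>, are excluded by
  \<open>coupled\<close>.\<close>

definition pending :: "nat \<Rightarrow> nat set \<Rightarrow> nat set" where
  "pending n K = {i. i < n \<and> i \<notin> K \<and> \<not> ret i \<or> n \<le> i \<and> i \<in> K \<and> ret i}"

text \<open>Multiplying in what the replay lacks, namely \<open>\<kappa>\<close>, calls not yet
  replayed and returns already replayed, makes its library state match the original one in
  footprint. \<open>total_base\<close> does the same for the full state.\<close>

definition lib_base :: "nat \<Rightarrow> nat set \<Rightarrow> 's \<Rightarrow> 's option" where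
  "lib_base n K l = Some l \<oplus> Some \<kappa> \<oplus> oprod (\<lambda>i. Some (g i)) (pending n K)"

definition total_base :: "nat \<Rightarrow> nat set \<Rightarrow> (nat \<Rightarrow> 's) \<Rightarrow> 's \<Rightarrow> 's option" where
  "total_base n K y T = Some T \<oplus> Some \<kappa> \<oplus> oprod (\<lambda>i. Some (y i)) (pending n K)"

text \<open>The original execution has performed the actions below \<open>n\<close>, the replay those in \<open>K\<close>; \<open>l\<close> and
  \<open>T\<close> are the states of the replay with respect to \<open>\<Gamma>\<close> and \<open>\<Gamma>'\<close>.  Actions are reordered such that
  the replay performs returns early and calls late, hence the pending actions account for the
  difference.  The states \<open>y\<close> actually transferred by the replay's returns are only known to agree
  with those in \<open>H\<close> once the original execution has performed these returns as well.\<close>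

definition coupled :: "nat \<Rightarrow> nat set \<Rightarrow> 's \<Rightarrow> 's \<Rightarrow> (nat \<Rightarrow> 's) \<Rightarrow> bool" where
  "coupled n K l T y \<longleftrightarrow> n \<le> length H \<and> K \<subseteq> {..<length H} \<and>
     (\<forall>i\<in>K. \<not> ret i \<longrightarrow> i < n) \<and> (\<forall>i<n. ret i \<longrightarrow> i \<in> K) \<and>
     (\<forall>i. \<not> ret i \<longrightarrow> y i = h i) \<and>
     (\<forall>i\<in>K. \<forall>t m \<sigma>. H ! i = (t, IRet m \<sigma>) \<longrightarrow> y i \<in> post \<Gamma>' m t) \<and>
     ofp (lib_base n K l) = Some (footprint (ls n)) \<and>
     lib_base n K l \<oplus> Some (es n) = total_base n K y T"

lemma coupled_bounds:
  assumes "coupled n K l T y"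
  shows "n \<le> length H" "K \<subseteq> {..<length H}" "i < n \<Longrightarrow> ret i \<Longrightarrow> i \<in> K"
  using assms by (simp_all add: coupled_def)

text \<open>\<open>lib_base n K l\<close> has the footprint of \<open>ls n\<close>, which is
  compatible with \<open>es n\<close>. Definedness of the replayed calls is drawn from this
  product.\<close>

lemma coupled_defined:
  assumes "coupled n K l T y"
  shows "lib_base n K l \<oplus> Some (es n) \<noteq> None"
proof -
  have "ofp (lib_base n K l) = ofp (Some (ls n))" and "n \<le> length H"
    using assms by (simp_all add: coupled_def)
  then show ?thesis
    using ofp_ocomp[of "lib_base n K l" "Some (ls n)" "Some (es n)"] compatible
    by (metis ocomp_simps(1) ofp_None_iff)
qed

lemma finite_pending:
  assumes "K \<subseteq> {..<length H}"
  shows "finite (pending n K)"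
proof -
  have "pending n K \<subseteq> {..<n} \<union> K" by (auto simp: pending_def)
  then show ?thesis using assms finite_subset by (metis finite_UnI finite_lessThan)
qed

text \<open>The original performs action \<open>n\<close> while the replay waits. A call becomes
  pending and contributes its payload to both sides; a return, already replayed, stops being pending
  and its payload cancels.\<close>

lemma coupled_advance_step:
  assumes "coupled n K l T y" "n < length H" "ret n \<Longrightarrow> n \<in> K"
  shows "coupled (Suc n) K l T y \<and> (ret n \<longrightarrow> y n = h n)"
proof -
  have K: "K \<subseteq> {..<length H}" using assms(1) by (simp add: coupled_def)
  have fp: "ofp (lib_base n K l) = Some (footprint (ls n))"
    and eq: "lib_base n K l \<oplus> Some (es n) = total_base n K y T"
    using assms(1) by (simp_all add: coupled_def)
  note fin = finite_pending[OF K]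
  from split_steps[OF assms(2)] show ?thesis
  proof (cases rule: split_step.cases)
    case (Call m h' t g' x l1)
    have hg: "h n = h'" "g n = g'" using Call by (simp_all add: h_def g_def)
    have n: "\<not> ret n" using Call by simp
    then have "n \<notin> K" using assms(1) by (auto simp: coupled_def)
    have pend: "pending (Suc n) K = insert n (pending n K)"
    proof (rule set_eqI)
      fix i show "i \<in> pending (Suc n) K \<longleftrightarrow> i \<in> insert n (pending n K)"
        using n \<open>n \<notin> K\<close> by (cases "i = n") (auto simp: pending_def)
    qed
    have "n \<notin> pending n K" using n by (simp add: pending_def)
    have yn: "y n = h n" using n assms(1) by (auto simp: coupled_def)
    have lib: "lib_base (Suc n) K l = lib_base n K l \<oplus> Some g'"
      using fin \<open>n \<notin> pending n K\<close> unfolding lib_base_def pend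
      by (simp add: hg ocomp_ac del: ocomp_simps)
    have tot: "total_base (Suc n) K y T = total_base n K y T \<oplus> Some h'"
      using fin \<open>n \<notin> pending n K\<close> unfolding total_base_def pend
      by (simp add: yn hg ocomp_ac del: ocomp_simps)
    have "ofp (lib_base (Suc n) K l) = ofp (Some (ls n) \<oplus> Some g')"
      unfolding lib using fp by (intro ofp_ocomp) simp
    then have "ofp (lib_base (Suc n) K l) = Some (footprint (ls (Suc n)))"
      using Call by simp
    moreover have "lib_base (Suc n) K l \<oplus> Some (es (Suc n)) = total_base (Suc n) K y T"
    proof -
      have "lib_base (Suc n) K l \<oplus> Some (es (Suc n)) =
          lib_base n K l \<oplus> Some g' \<oplus> (Some (es n) \<oplus> Some x)"
        unfolding lib using Call by simp
      also have "\<dots> = (lib_base n K l \<oplus> Some (es n)) \<oplus> (Some g' \<oplus> Some x)"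
        by (simp only: ocomp_ac)
      also have "\<dots> = total_base (Suc n) K y T" unfolding tot eq using Call by simp
      finally show ?thesis .
    qed
    ultimately show ?thesis
      using assms(1,2) n unfolding coupled_def by (auto simp: less_Suc_eq)
  next
    case (Ret m h' t g' x l1)
    have hg: "h n = h'" "g n = g'" using Ret by (simp_all add: h_def g_def)
    have n: "ret n" using Ret by simp
    then have "n \<in> K" using assms(3) by simp
    have pend: "pending (Suc n) K = pending n K - {n}"
    proof (rule set_eqI)
      fix i show "i \<in> pending (Suc n) K \<longleftrightarrow> i \<in> pending n K - {n}"
        using n \<open>n \<in> K\<close> by (cases "i = n") (auto simp: pending_def)
    qed
    have n_in: "n \<in> pending n K" using n \<open>n \<in> K\<close> by (simp add: pending_def)
    have lib: "lib_base n K l = Some g' \<oplus> lib_base (Suc n) K l"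
      unfolding lib_base_def pend sep_prod.remove[OF fin n_in] hg by (simp only: ocomp_ac)
    have tot: "total_base n K y T = Some (y n) \<oplus> total_base (Suc n) K y T"
      unfolding total_base_def pend sep_prod.remove[OF fin n_in] by (simp only: ocomp_ac)
    have "lib_base n K l \<oplus> Some (es n) =
        Some g' \<oplus> lib_base (Suc n) K l \<oplus> (Some x \<oplus> Some (es (Suc n)))"
      unfolding lib using Ret by simp
    also have "\<dots> = (Some g' \<oplus> Some x) \<oplus> (lib_base (Suc n) K l \<oplus> Some (es (Suc n)))"
      by (simp only: ocomp_ac)
    also have "\<dots> = Some h' \<oplus> (lib_base (Suc n) K l \<oplus> Some (es (Suc n)))" using Ret by simp
    finally have *: "Some h' \<oplus> (lib_base (Suc n) K l \<oplus> Some (es (Suc n))) =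
        Some (y n) \<oplus> total_base (Suc n) K y T"
      and defined: "Some h' \<oplus> (lib_base (Suc n) K l \<oplus> Some (es (Suc n))) \<noteq> None"
      using eq tot coupled_defined[OF assms(1)] by auto
    \<comment> \<open>Precision settles what the replay returned: \<open>h'\<close> and
      \<open>y n\<close> both lie in the postcondition and divide the same defined state.\<close>
    have "precise (post \<Gamma>' m t)" using method_spec Ret by (auto simp: method_spec_def)
    moreover have "y n \<in> post \<Gamma>' m t" using assms(1) \<open>n \<in> K\<close> Ret by (auto simp: coupled_def)
    ultimately have "h' = y n" using precise_ocomp[OF _ _ _ * defined] Ret by blast
    then have "lib_base (Suc n) K l \<oplus> Some (es (Suc n)) = total_base (Suc n) K y T"
      using ocomp_cancel * defined by blast
    moreover have "ofp (lib_base (Suc n) K l) = ofp (Some l1)"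
    proof (rule ofp_cancel)
      show "ofp (Some g' \<oplus> lib_base (Suc n) K l) = ofp (Some g' \<oplus> Some l1)"
        using fp Ret unfolding lib by simp
      show "Some g' \<oplus> lib_base (Suc n) K l \<noteq> None" using fp unfolding lib by (auto simp: ofp_def)
    qed
    ultimately show ?thesis
      using assms(1,2) \<open>n \<in> K\<close> \<open>h' = y n\<close> Ret hg unfolding coupled_def by (auto simp: less_Suc_eq)
  qed
qed

text \<open>The original may run ahead as long as all returns on its way have been replayed; each
  one passed confirms \<open>y\<close>.\<close>

lemma coupled_advance:
  assumes "coupled n K l T y" "n \<le> n'" "n' \<le> length H" "\<And>i. i < n' \<Longrightarrow> ret i \<Longrightarrow> i \<in> K"
  shows "coupled n' K l T y \<and> (\<forall>i. n \<le> i \<and> i < n' \<and> ret i \<longrightarrow> y i = h i)"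
  using assms(2-)
proof (induction n' rule: dec_induct)
  case base
  then show ?case using assms(1) by auto
next
  case (step n')
  have IH: "coupled n' K l T y" "\<forall>i. n \<le> i \<and> i < n' \<and> ret i \<longrightarrow> y i = h i"
    using step.IH step.prems by auto
  have "coupled (Suc n') K l T y \<and> (ret n' \<longrightarrow> y n' = h n')"
    using coupled_advance_step[OF IH(1)] step.prems by auto
  then show ?case using IH(2) by (auto simp: less_Suc_eq)
qed

section \<open>Steps of the replay while the original waits\<close>

text \<open>\<open>l\<close> and \<open>T\<close> extend to a common state \<open>V\<close> by
  frames \<open>p\<close> and \<open>q\<close>. Strong locality describes the outcomes from
  \<open>V\<close> in both ways, so the composition of \<open>l'\<close> and \<open>p\<close> is
  also that of some \<open>T' \<in> B\<close> and \<open>q\<close>.\<close>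

lemma coupled_prim:
  assumes "coupled n K l T y" "f t c l = Val A" "l' \<in> A" "f t c T = Val B"
  obtains T' where "T' \<in> B" "coupled n K l' T' y"
proof -
  define P where "P = Some \<kappa> \<oplus> oprod (\<lambda>i. Some (g i)) (pending n K)"
  define Q where "Q = Some \<kappa> \<oplus> oprod (\<lambda>i. Some (y i)) (pending n K)"
  have lib: "lib_base n K k = Some k \<oplus> P" for k by (simp only: lib_base_def P_def ocomp_assoc)
  have tot: "total_base n K y k = Some k \<oplus> Q" for k by (simp only: total_base_def Q_def ocomp_assoc)
  have fp: "ofp (lib_base n K l) = Some (footprint (ls n))"
    and eq: "Some l \<oplus> (P \<oplus> Some (es n)) = Some T \<oplus> Q"
    using assms(1) unfolding coupled_def lib tot ocomp_assoc by blast+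
  have fp': "footprint l' = footprint l"
    using footprint_preserving assms(2,3) unfolding footprint_preserving_def by blast
  obtain V where V: "Some l \<oplus> (P \<oplus> Some (es n)) = Some V"
    using coupled_defined[OF assms(1)] by (auto simp: lib ocomp_assoc)
  then obtain p where p: "P \<oplus> Some (es n) = Some p" "l \<odot> p = Some V"
    by (auto simp: ocomp_eq_Some_iff)
  obtain q where q: "Q = Some q" "T \<odot> q = Some V"
    using V eq by (auto simp: ocomp_eq_Some_iff)
  have "f t c V = Val (A \<star> {p})" "f t c V = Val (B \<star> {q})"
    using strongly_local p(2) q(2) assms(2,4) unfolding strongly_local_def by blast+
  then have AB: "A \<star> {p} = B \<star> {q}" by simp
  obtain V' where V': "l' \<odot> p = Some V'"
    using footprint_eq_comp_right[OF fp'[symmetric] p(2)] by blast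
  then have "V' \<in> B \<star> {q}" using AB assms(3) by (auto simp: pred_comp_def)
  then obtain T' where T': "T' \<in> B" "T' \<odot> q = Some V'" by (auto simp: pred_comp_def)
  have "lib_base n K l' \<oplus> Some (es n) = total_base n K y T'"
    using V' T'(2) p(1) q(1) by (simp add: lib tot ocomp_assoc)
  moreover have "ofp (lib_base n K l') = ofp (lib_base n K l)"
    unfolding lib using fp' by (intro ofp_ocomp) simp
  ultimately have "coupled n K l' T' y" using assms(1) fp by (simp add: coupled_def)
  then show thesis using that T'(1) by blast
qed

text \<open>The payload moves from the pending product into the state, leaving both bases unchanged.
  Since \<open>T\<close> and \<open>h i\<close> are factors of the defined
  \<open>total_base\<close>, they compose.\<close>

lemma coupled_call:
  assumes "coupled n K l T y" "i < n" "i \<notin> K" "\<not> ret i" "l \<odot> g i = Some l'"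
  obtains T' where "T \<odot> h i = Some T'" "coupled n (insert i K) l' T' y"
proof -
  have K: "K \<subseteq> {..<length H}" "n \<le> length H" using assms(1) by (simp_all add: coupled_def)
  note fin = finite_pending[OF K(1)]
  have pend: "pending n (insert i K) = pending n K - {i}"
    using assms(2-4) by (auto simp: pending_def)
  have i_in: "i \<in> pending n K" using assms(2-4) by (simp add: pending_def)
  have yi: "y i = h i" using assms(1,4) by (simp add: coupled_def)
  have lib: "lib_base n K l = lib_base n (insert i K) l'"
    unfolding lib_base_def pend sep_prod.remove[OF fin i_in] assms(5)[symmetric] ocomp_simps(1)[symmetric]
    by (simp only: ocomp_ac)
  have tot: "total_base n K y T =
      (Some T \<oplus> Some (h i)) \<oplus> (Some \<kappa> \<oplus> oprod (\<lambda>i. Some (y i)) (pending n K - {i}))"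
    unfolding total_base_def sep_prod.remove[OF fin i_in] yi by (simp only: ocomp_ac)
  have "total_base n K y T \<noteq> None"
    using coupled_defined[OF assms(1)] assms(1) by (simp add: coupled_def)
  then obtain T' where T': "T \<odot> h i = Some T'" unfolding tot by (cases "T \<odot> h i") auto
  then have "Some T \<oplus> Some (h i) = Some T'" by simp
  then have "total_base n K y T = total_base n (insert i K) y T'"
    unfolding tot unfolding total_base_def pend by (simp only: ocomp_assoc[of "Some T'"])
  moreover have "i < length H" using assms(2) K(2) by simp
  moreover have "\<And>t m \<sigma>. H ! i \<noteq> (t, IRet m \<sigma>)" using assms(4) by auto
  ultimately have "coupled n (insert i K) l' T' y"
    using assms(1,2) lib unfolding coupled_def by auto
  then show thesis using that T' by blast
qed

text \<open>The returned state joins the pending product, so both bases are again unchanged.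
  \<open>y\<close> records \<open>s\<close>, which is not yet known to be
  \<open>h i\<close>.\<close>

lemma coupled_ret:
  assumes "coupled n K l T y" "i < length H" "i \<notin> K" "H ! i = (t, IRet m \<sigma>)"
    and "g i \<odot> l' = Some l" "s \<in> post \<Gamma>' m t" "s \<odot> T' = Some T"
  shows "n \<le> i" "coupled n (insert i K) l' T' (y(i := s))"
proof -
  have K: "K \<subseteq> {..<length H}" using assms(1) by (simp add: coupled_def)
  note fin = finite_pending[OF K]
  have i: "ret i" using assms(4) by simp
  show "n \<le> i" using assms(1,3) i unfolding coupled_def by (meson not_le)
  have pend: "pending n (insert i K) = insert i (pending n K)"
    using \<open>n \<le> i\<close> i by (auto simp: pending_def)
  have i_out: "i \<notin> pending n K" using assms(3) i by (simp add: pending_def)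
  have lib: "lib_base n K l = lib_base n (insert i K) l'"
    unfolding lib_base_def pend sep_prod.insert[OF fin i_out] assms(5)[symmetric] ocomp_simps(1)[symmetric]
    by (simp only: ocomp_ac)
  have "oprod (\<lambda>j. Some ((y(i := s)) j)) (pending n K) = oprod (\<lambda>j. Some (y j)) (pending n K)"
    by (rule sep_prod.cong) (use i_out in auto)
  then have tot: "total_base n K y T = total_base n (insert i K) (y(i := s)) T'"
    unfolding total_base_def pend sep_prod.insert[OF fin i_out] assms(7)[symmetric] ocomp_simps(1)[symmetric]
    by (simp add: ocomp_ac del: ocomp_simps)
  show "coupled n (insert i K) l' T' (y(i := s))"
    unfolding coupled_def
  proof (intro conjI)
    show "\<forall>j\<in>insert i K. \<forall>t m \<sigma>. H ! j = (t, IRet m \<sigma>) \<longrightarrow> (y(i := s)) j \<in> post \<Gamma>' m t"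
      using assms(1,4,6) by (simp add: coupled_def)
    show "ofp (lib_base n (insert i K) l') = Some (footprint (ls n))"
      and "lib_base n (insert i K) l' \<oplus> Some (es n) = total_base n (insert i K) (y(i := s)) T'"
      using assms(1) unfolding coupled_def lib tot by blast+
  qed (use assms(1,2) i in \<open>simp_all add: coupled_def\<close>)
qed

section \<open>Induction along the replayed trace\<close>

text \<open>\<open>is\<close> lists the positions still to be replayed. Returned states are
  confirmed only once the original catches up, so the last conjunct passes this knowledge back
  through the induction to the return step.\<close>

lemma replay:
  assumes "coupled n K l T y"
    and "eval_trace f \<Gamma> \<tau> l = Val A" "(l', \<mu>) \<in> A" "history \<mu> = map ((!) G) is"
    and "eval_trace f \<Gamma>' \<tau> T = Val B"
    and "distinct is" "set is = {..<length H} - K"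
    and "sorted_wrt (\<lambda>i j. \<not> ret i \<longrightarrow> ret j \<longrightarrow> i < j) is"
  shows "\<exists>T' \<nu>. (T', \<nu>) \<in> B \<and> history \<nu> = map ((!) H) is \<and>
    (\<forall>i\<in>K. ret i \<longrightarrow> n \<le> i \<longrightarrow> y i = h i)"
  using assms
proof (induction \<tau> arbitrary: n K l T y A \<mu> "is" B)
  case Nil
  have "is = []" using Nil.prems(2-4) by auto
  then have "{..<length H} \<subseteq> K" using Nil.prems(7) by auto
  \<comment> \<open>With everything replayed, the original can run to its end, which confirms all
    pending returns.\<close>
  then have "\<forall>i. n \<le> i \<and> i < length H \<and> ret i \<longrightarrow> y i = h i"
    using coupled_advance[OF Nil.prems(1) coupled_bounds(1)[OF Nil.prems(1)]] by auto
  then have "\<forall>i\<in>K. ret i \<longrightarrow> n \<le> i \<longrightarrow> y i = h i"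
    using coupled_bounds(2)[OF Nil.prems(1)] by blast
  then show ?case using Nil.prems(5) \<open>is = []\<close> by (intro exI[of _ T] exI[of _ "[]"]) auto
next
  case (Cons a \<tau>)
  obtain A1 l1 \<phi> C \<mu>' where A1: "step f \<Gamma> a l = Val A1" "(l1, \<phi>) \<in> A1"
    "eval_trace f \<Gamma> \<tau> l1 = Val C" "(l', \<mu>') \<in> C" "\<mu> = \<phi> # \<mu>'"
    using eval_trace_ConsE[OF Cons.prems(2,3)] .
  obtain B1 where B1: "step f \<Gamma>' a T = Val B1" "\<And>T1 \<psi>. (T1, \<psi>) \<in> B1 \<Longrightarrow>
      \<exists>D. eval_trace f \<Gamma>' \<tau> T1 = Val D \<and> (\<forall>T' \<nu>. (T', \<nu>) \<in> D \<longrightarrow> (T', \<psi> # \<nu>) \<in> B)"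
    using eval_trace_Cons_Val[OF Cons.prems(5)] by metis
  have IH: "\<exists>T' \<nu>. (T', \<psi> # \<nu>) \<in> B \<and> history \<nu> = map ((!) H) is' \<and>
      (\<forall>i\<in>K'. ret i \<longrightarrow> n' \<le> i \<longrightarrow> y' i = h i)"
    if prems: "(T1, \<psi>) \<in> B1" "coupled n' K' l1 T1 y'" "history \<mu>' = map ((!) G) is'"
      "distinct is'" "set is' = {..<length H} - K'"
      "sorted_wrt (\<lambda>i j. \<not> ret i \<longrightarrow> ret j \<longrightarrow> i < j) is'" for T1 \<psi> n' K' y' is'
  proof -
    obtain D where D: "eval_trace f \<Gamma>' \<tau> T1 = Val D" "\<forall>T' \<nu>. (T', \<nu>) \<in> D \<longrightarrow> (T', \<psi> # \<nu>) \<in> B"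
      using B1(2) prems(1) by blast
    show ?thesis
      using Cons.IH[OF prems(2) A1(3,4) prems(3) D(1) prems(4-6)] D(2) by blast
  qed
  obtain t b where a: "a = (t, b)" by (cases a)
  show ?case
  proof (cases b)
    case (Do c)
    obtain D where D: "f t c l = Val D" "l1 \<in> D" "\<phi> = (t, ADo c)"
      using A1(1,2) a Do by (cases "f t c l") auto
    obtain E where E: "f t c T = Val E" "B1 = {(T1, (t, ADo c)) | T1. T1 \<in> E}"
      using B1(1) a Do by (cases "f t c T") auto
    obtain T1 where T1: "T1 \<in> E" "coupled n K l1 T1 y"
      using coupled_prim[OF Cons.prems(1) D(1,2) E(1)] .
    have "(T1, (t, ADo c)) \<in> B1" using T1(1) E(2) by blast
    moreover have "history \<mu>' = map ((!) G) is" using Cons.prems(4) A1(5) D(3) by simp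
    ultimately obtain T' \<nu> where "(T', (t, ADo c) # \<nu>) \<in> B" "history \<nu> = map ((!) H) is"
      "\<forall>i\<in>K. ret i \<longrightarrow> n \<le> i \<longrightarrow> y i = h i"
      using IH[OF _ T1(2) _ Cons.prems(6-8)] by blast
    then show ?thesis by (intro exI[of _ T'] exI[of _ "(t, ADo c) # \<nu>"]) simp
  next
    case (Call m)
    obtain p where p: "\<phi> = (t, AIface (ICall m p))" "l \<odot> p = Some l1"
      using A1(1,2) a Call by auto
    obtain i is' where is': "is = i # is'" "G ! i = (t, ICall m p)" "history \<mu>' = map ((!) G) is'"
      using Cons.prems(4) A1(5) p(1) by (cases "is") auto
    have i: "i < length H" "i \<notin> K" using Cons.prems(7) is'(1) by auto
    obtain v where v: "H ! i = (t, ICall m v)" "v \<in> pre \<Gamma>' m t"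
      using split_steps[OF i(1)] is'(2) by (cases rule: split_step.cases) auto
    have gi: "g i = p" and hi: "h i = v" using is'(2) v by (simp_all add: g_def h_def)
    \<comment> \<open>A return before \<open>i\<close> that is not yet replayed would follow this
      call in \<open>is\<close>, against the sorting.\<close>
    have returned: "j \<in> K" if "j < i" "ret j" for j
    proof (rule ccontr)
      assume "j \<notin> K"
      then have "j \<in> set is" using that(1) i(1) Cons.prems(7) by simp
      then have "j \<in> set is'" using is'(1) that(1) by simp
      moreover have "\<forall>j\<in>set is'. \<not> ret i \<longrightarrow> ret j \<longrightarrow> i < j" using Cons.prems(8) is'(1) by simp
      ultimately have "i < j" using that(2) v(1) by simp
      then show False using that(1) by simp
    qed
    \<comment> \<open>The original has to pass the call at \<open>i\<close> before the replay
      performs it, but may already be further.\<close>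
    define n' where "n' = max n (Suc i)"
    have n': "n \<le> n'" "i < n'" "n' \<le> length H"
      using i(1) coupled_bounds(1)[OF Cons.prems(1)] by (auto simp: n'_def)
    have "j \<in> K" if "j < n'" "ret j" for j
      using that returned[of j] coupled_bounds(3)[OF Cons.prems(1), of j] v(1)
      by (cases "j = i") (auto simp: n'_def less_max_iff_disj less_Suc_eq)
    then have adv: "coupled n' K l T y" "\<forall>j. n \<le> j \<and> j < n' \<and> ret j \<longrightarrow> y j = h j"
      using coupled_advance[OF Cons.prems(1) n'(1,3)] by auto
    obtain T1 where T1: "T \<odot> v = Some T1" "coupled n' (insert i K) l1 T1 y"
      using coupled_call[OF adv(1) n'(2) i(2), of l1] v(1) p(2) gi hi by auto
    have "(T1, (t, AIface (ICall m v))) \<in> B1" using B1(1) a Call T1(1) v(2) by auto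
    moreover have "set is' = {..<length H} - insert i K" "distinct is'"
      using Cons.prems(6,7) is'(1) by auto
    moreover have "sorted_wrt (\<lambda>i j. \<not> ret i \<longrightarrow> ret j \<longrightarrow> i < j) is'"
      using Cons.prems(8) is'(1) by simp
    ultimately obtain T' \<nu> where *: "(T', (t, AIface (ICall m v)) # \<nu>) \<in> B"
      "history \<nu> = map ((!) H) is'" "\<forall>j\<in>insert i K. ret j \<longrightarrow> n' \<le> j \<longrightarrow> y j = h j"
      using IH[OF _ T1(2) is'(3)] by blast
    have "\<forall>j\<in>K. ret j \<longrightarrow> n \<le> j \<longrightarrow> y j = h j" using *(3) adv(2) by (meson insertI2 not_le)
    then show ?thesis using * is'(1) v(1)
      by (intro exI[of _ T'] exI[of _ "(t, AIface (ICall m v)) # \<nu>"]) simp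
  next
    case (Ret m)
    obtain q where q: "\<phi> = (t, AIface (IRet m q))" "q \<odot> l1 = Some l"
      using A1(1,2) a Ret by (auto split: option.splits)
    obtain i is' where is': "is = i # is'" "G ! i = (t, IRet m q)" "history \<mu>' = map ((!) G) is'"
      using Cons.prems(4) A1(5) q(1) by (cases "is") auto
    have i: "i < length H" "i \<notin> K" using Cons.prems(7) is'(1) by auto
    obtain v where v: "H ! i = (t, IRet m v)" "m \<in> dom \<Gamma>'"
      using split_steps[OF i(1)] is'(2) by (cases rule: split_step.cases) auto
    have gi: "g i = q" and hi: "h i = v" using is'(2) v by (simp_all add: g_def h_def)
    have prec: "precise (post \<Gamma>' m t)" using method_spec v(2) by (auto simp: method_spec_def)
    obtain T1 where T1: "pred_diff T (post \<Gamma>' m t) = Some T1"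
      using B1(1) a Ret by (auto split: option.splits)
    then obtain s where s: "s \<in> post \<Gamma>' m t" "s \<odot> T1 = Some T"
      using prec by (auto simp: pred_diff_eq_Some)
    have "g i \<odot> l1 = Some l" using q(2) gi by simp
    note cr = coupled_ret[OF Cons.prems(1) i v(1) this s]
    have "(T1, (t, AIface (IRet m s))) \<in> B1" using B1(1) a Ret T1 s by auto
    moreover have "set is' = {..<length H} - insert i K" "distinct is'"
      using Cons.prems(6,7) is'(1) by auto
    moreover have "sorted_wrt (\<lambda>i j. \<not> ret i \<longrightarrow> ret j \<longrightarrow> i < j) is'"
      using Cons.prems(8) is'(1) by simp
    ultimately obtain T' \<nu> where *: "(T', (t, AIface (IRet m s)) # \<nu>) \<in> B"
      "history \<nu> = map ((!) H) is'"
      "\<forall>j\<in>insert i K. ret j \<longrightarrow> n \<le> j \<longrightarrow> (y(i := s)) j = h j"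
      using IH[OF _ cr(2) is'(3)] by blast
    \<comment> \<open>The return at \<open>i\<close> is pending after this step, so the induction
      hypothesis confirms the recorded \<open>s\<close>.\<close>
    have "s = v" using *(3) cr(1) v(1) hi by auto
    moreover have "\<forall>j\<in>K. ret j \<longrightarrow> n \<le> j \<longrightarrow> y j = h j" using *(3) i(2) by (metis fun_upd_other insertI2)
    ultimately show ?thesis using * is'(1) v(1)
      by (intro exI[of _ T'] exI[of _ "(t, AIface (IRet m s)) # \<nu>"]) simp
  qed
qed


text \<open>Nothing is pending, so both sides are the product of \<open>l\<close>,
  \<open>\<kappa>\<close> and \<open>es 0\<close>. As no return has been replayed, \<open>h\<close>
  can serve as \<open>y\<close>.\<close>

lemma coupled_initial:
  assumes "footprint (ls 0) = footprint c" "l \<odot> \<kappa> = Some c" "l \<odot> es 0 = Some T"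
  shows "coupled 0 {} l T h"
proof -
  have "pending 0 {} = {}" by (simp add: pending_def)
  then have lib: "lib_base 0 {} l = Some c" and tot: "total_base 0 {} h T = Some T \<oplus> Some \<kappa>"
    using assms(2) by (simp_all add: lib_base_def total_base_def sep_prod.comm_neutral
        del: ocomp_simps) (simp_all add: sep_unit)
  have "Some c \<oplus> Some (es 0) = (Some l \<oplus> Some \<kappa>) \<oplus> Some (es 0)" using assms(2) by simp
  also have "\<dots> = (Some l \<oplus> Some (es 0)) \<oplus> Some \<kappa>" by (simp only: ocomp_ac)
  also have "\<dots> = Some T \<oplus> Some \<kappa>" using assms(3) by simp
  finally show ?thesis unfolding coupled_def lib tot using assms(1) by simp
qed

end


section \<open>Linearizability under extended specifications\<close>

text \<open>Inverting the bijection lists the positions in the order of \<open>W\<close>. A call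
  listed before a return cannot come after it in \<open>G\<close>, because \<open>hist_le\<close>
  keeps a return before each later call.\<close>

lemma hist_le_listing:
  assumes "hist_le G W" "length H = length G"
    and "\<And>i. i < length G \<Longrightarrow>
      fst (H ! i) = fst (G ! i) \<and> is_ret (snd (H ! i)) = is_ret (snd (G ! i))"
  obtains "is" where "distinct is" "set is = {..<length H}" "W = map ((!) G) is"
    "sorted_wrt (\<lambda>i j. \<not> is_ret (snd (H ! i)) \<longrightarrow> is_ret (snd (H ! j)) \<longrightarrow> i < j) is"
    "hist_le H (map ((!) H) is)"
proof -
  let ?N = "length G"
  obtain \<rho> where bij: "bij_betw \<rho> {..<?N} {..<length W}" and eq: "\<forall>i<?N. G ! i = W ! \<rho> i"
    and ord: "\<forall>i j. i < j \<and> j < ?N \<and> (fst (G ! i) = fst (G ! j) \<or>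
      is_ret (snd (G ! i)) \<and> is_call (snd (G ! j))) \<longrightarrow> \<rho> i < \<rho> j"
    using assms(1) unfolding hist_le_def by blast
  have len: "length W = ?N" using bij_betw_same_card[OF bij] by simp
  define \<theta> where "\<theta> = inv_into {..<?N} \<rho>"
  have bij': "bij_betw \<theta> {..<?N} {..<?N}"
    unfolding \<theta>_def using bij_betw_inv_into[OF bij] len by simp
  have \<theta>: "\<theta> k < ?N" "\<rho> (\<theta> k) = k" if "k < ?N" for k
    using that bij_betwE[OF bij'] bij_betw_inv_into_right[OF bij] len unfolding \<theta>_def by auto
  have \<rho>: "\<rho> i < ?N" "\<theta> (\<rho> i) = i" if "i < ?N" for i
    using that bij_betwE[OF bij] bij_betw_inv_into_left[OF bij] len unfolding \<theta>_def by auto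
  show thesis
  proof
    show "distinct (map \<theta> [0..<?N])"
      using bij' by (simp add: distinct_map bij_betw_def atLeast0LessThan)
    show "set (map \<theta> [0..<?N]) = {..<length H}"
      using bij' assms(2) by (simp add: bij_betw_def atLeast0LessThan)
    show "W = map ((!) G) (map \<theta> [0..<?N])"
      using len eq \<theta> by (intro nth_equalityI) simp_all
    show "sorted_wrt (\<lambda>i j. \<not> is_ret (snd (H ! i)) \<longrightarrow> is_ret (snd (H ! j)) \<longrightarrow> i < j)
        (map \<theta> [0..<?N])"
      unfolding sorted_wrt_iff_nth_less
    proof (intro allI impI)
      fix k k' assume "k < k'" "k' < length (map \<theta> [0..<?N])"
        and ret: "\<not> is_ret (snd (H ! (map \<theta> [0..<?N] ! k)))"
        "is_ret (snd (H ! (map \<theta> [0..<?N] ! k')))"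
      then have k: "k < k'" "k < ?N" "k' < ?N" by simp_all
      have "\<not> is_ret (snd (G ! \<theta> k))" "is_ret (snd (G ! \<theta> k'))"
        using ret k assms(3) \<theta>(1) by auto
      moreover from this(1) have "is_call (snd (G ! \<theta> k))" by (cases "snd (G ! \<theta> k)") auto
      ultimately have "\<theta> k' < \<theta> k \<Longrightarrow> \<rho> (\<theta> k') < \<rho> (\<theta> k)" using ord \<theta>(1) k by blast
      moreover have "\<theta> k \<noteq> \<theta> k'" using \<theta>(2) k by (metis less_irrefl)
      ultimately have "\<theta> k < \<theta> k'" using \<theta>(2) k by (metis less_asym linorder_neqE_nat)
      then show "map \<theta> [0..<?N] ! k < map \<theta> [0..<?N] ! k'" using k by simp
    qed
    have call: "is_call (snd (H ! i)) = is_call (snd (G ! i))" if "i < ?N" for i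
      using assms(3)[OF that] by (cases "snd (H ! i)"; cases "snd (G ! i)") auto
    \<comment> \<open>The ordering condition depends only on threads and kinds of actions, so the
      same \<open>\<rho>\<close> works for \<open>H\<close>.\<close>
    show "hist_le H (map ((!) H) (map \<theta> [0..<?N]))"
      unfolding hist_le_def
    proof (intro exI[of _ \<rho>] conjI allI impI)
      show "bij_betw \<rho> {..<length H} {..<length (map ((!) H) (map \<theta> [0..<?N]))}"
        using bij len assms(2) by simp
      show "H ! i = map ((!) H) (map \<theta> [0..<?N]) ! \<rho> i" if "i < length H" for i
        using that assms(2) \<rho> by simp
      show "\<rho> i < \<rho> j" if "i < j \<and> j < length H \<and> (fst (H ! i) = fst (H ! j) \<or>
          is_ret (snd (H ! i)) \<and> is_call (snd (H ! j)))" for i j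
        using that ord assms(2,3) call by auto
    qed
  qed
qed

section \<open>Footprint order and safe executions\<close>

lemma fp_le_footprintE:
  assumes "footprint a \<preceq> footprint b"
  obtains \<kappa> c where "a \<odot> \<kappa> = Some c" "footprint c = footprint b"
proof -
  obtain \<sigma>1 \<sigma>2 \<sigma> where "footprint a = footprint \<sigma>1" "footprint b = footprint \<sigma>2" "\<sigma>1 \<odot> \<sigma> = Some \<sigma>2"
    using assms unfolding fp_le_def fp_diff_def by (auto split: if_splits)
  then show thesis using that footprint_eq_comp_right by metis
qed

lemma lib_sem_ValD:
  assumes "lib_sem f L \<Gamma> \<sigma> = Val A" "\<mu> \<in> A"
  obtains \<tau> B \<sigma>' where "\<tau> \<in> lib_traces L" "eval_trace f \<Gamma> \<tau> \<sigma> = Val B" "(\<sigma>', \<mu>) \<in> B"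
  using assms unfolding lib_sem_def by (auto split: if_splits)

lemma lib_sem_safe:
  assumes "lib_sem f L \<Gamma> \<sigma> \<noteq> Top" "\<tau> \<in> lib_traces L"
  obtains A B where "lib_sem f L \<Gamma> \<sigma> = Val A" "eval_trace f \<Gamma> \<tau> \<sigma> = Val B"
    "\<forall>\<sigma>' \<mu>. (\<sigma>', \<mu>) \<in> B \<longrightarrow> \<mu> \<in> A"
proof -
  have "eval_trace f \<Gamma> \<tau> \<sigma> \<noteq> Top" using assms unfolding lib_sem_def by (auto split: if_splits)
  then obtain B where B: "eval_trace f \<Gamma> \<tau> \<sigma> = Val B" by (cases "eval_trace f \<Gamma> \<tau> \<sigma>") auto
  obtain A where A: "lib_sem f L \<Gamma> \<sigma> = Val A" using assms(1) by (cases "lib_sem f L \<Gamma> \<sigma>") auto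
  have "\<mu> \<in> A" if "(\<sigma>', \<mu>) \<in> B" for \<sigma>' \<mu>
    using that A B assms(2) unfolding lib_sem_def by (auto split: if_splits)
  then show thesis using that A B by blast
qed

theorem theorem8p2:
  fixes f :: "('c, 's::footprint_sep_algebra) transformer"
    and M :: "'m set"
    and L1 L2 :: "('m, 'c) library"
    and \<Gamma> \<Gamma>' :: "('m, 's) mspec"
    and I1 I2 I :: "'s set"
  assumes "footprint_preserving f" and "strongly_local f"
    and "dom L1 = M" and "dom L2 = M" and "dom \<Gamma> = M" and "dom \<Gamma>' = M"
    and "method_spec \<Gamma>" and "method_spec \<Gamma>'"
    and "extends \<Gamma>' \<Gamma>"
    and "safe_for f L1 \<Gamma> I1" and "safe_for f L1 \<Gamma>' (I1 \<star> I)"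
    and "safe_for f L2 \<Gamma> I2" and "safe_for f L2 \<Gamma>' (I2 \<star> I)"
    and "linearizes_to f \<Gamma> L1 I1 L2 I2"
    and "\<And>\<sigma>0 \<sigma>0' \<sigma> A \<mu>. \<sigma>0 \<in> I1 \<Longrightarrow> \<sigma>0' \<in> I \<Longrightarrow> \<sigma>0 \<odot> \<sigma>0' = Some \<sigma> \<Longrightarrow>
           lib_sem f L1 \<Gamma>' \<sigma> = Val A \<Longrightarrow> \<mu> \<in> A \<Longrightarrow>
           \<exists>H. strip \<Gamma> (history \<mu>) = Some H \<and> run_hist H \<sigma>0' \<noteq> Top"
  shows "linearizes_to f \<Gamma>' L1 (I1 \<star> I) L2 (I2 \<star> I)"
  unfolding linearizes_to_def bhists_le_def
proof
  note fp = assms(1) and sl = assms(2) and spec = assms(7,8)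
  fix x assume x_in: "x \<in> interf f L1 \<Gamma>' (I1 \<star> I)"
  then obtain \<sigma> \<mu> A where x: "x = (footprint \<sigma>, history \<mu>)" "\<sigma> \<in> I1 \<star> I"
    "lib_sem f L1 \<Gamma>' \<sigma> = Val A" "\<mu> \<in> A"
    unfolding interf_def by blast
  obtain \<sigma>0 \<sigma>0' where \<sigma>0: "\<sigma>0 \<in> I1" "\<sigma>0' \<in> I" "\<sigma>0 \<odot> \<sigma>0' = Some \<sigma>"
    using x(2) by (auto simp: pred_comp_def)
  obtain \<tau> A' \<sigma>' where \<tau>: "\<tau> \<in> lib_traces L1" "eval_trace f \<Gamma>' \<tau> \<sigma> = Val A'" "(\<sigma>', \<mu>) \<in> A'"
    using lib_sem_ValD[OF x(3,4)] .
  \<comment> \<open>Safety under \<open>\<Gamma>\<close> lets the same trace run from the library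
    part alone, as splitting requires.\<close>
  have "lib_sem f L1 \<Gamma> \<sigma>0 \<noteq> Top" using assms(10) \<sigma>0(1) by (simp add: safe_for_def)
  from lib_sem_safe[OF this \<tau>(1)] obtain B B' where B: "lib_sem f L1 \<Gamma> \<sigma>0 = Val B"
    "eval_trace f \<Gamma> \<tau> \<sigma>0 = Val B'" "\<forall>\<sigma>' \<mu>. (\<sigma>', \<mu>) \<in> B' \<longrightarrow> \<mu> \<in> B" .
  obtain X where X: "strip \<Gamma> (history \<mu>) = Some X" "run_hist X \<sigma>0' \<noteq> Top"
    using assms(15)[OF \<sigma>0 x(3,4)] by blast
  have methods: "m \<in> dom \<Gamma> \<and> m \<in> dom \<Gamma>'" if "(t, Call m) \<in> set \<tau> \<or> (t, Ret m) \<in> set \<tau>" for t m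
    using lib_traces_methods[OF \<tau>(1) that] assms(3,5,6) by simp
  obtain l' \<nu> ls es where \<nu>: "(l', \<nu>) \<in> B'"
    and run: "split_run \<Gamma>' (history \<mu>) (history \<nu>) \<sigma>0 \<sigma>0' ls es"
    using split_trace[OF fp sl spec \<tau>(2,3) B(2) \<sigma>0(3) X] methods by meson
  let ?H = "history \<mu>" and ?G = "history \<nu>"
  have "(footprint \<sigma>0, ?G) \<in> interf f L1 \<Gamma> I1"
    using \<sigma>0(1) B(1) B(3) \<nu> unfolding interf_def by blast
  then obtain z where z: "z \<in> interf f L2 \<Gamma> I2" "bhist_le (footprint \<sigma>0, ?G) z"
    using assms(14) unfolding linearizes_to_def bhists_le_def by blast
  then obtain s0 \<omega> C where s0: "z = (footprint s0, history \<omega>)" "s0 \<in> I2"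
    "lib_sem f L2 \<Gamma> s0 = Val C" "\<omega> \<in> C"
    unfolding interf_def by blast
  obtain \<tau>2 C' s' where \<tau>2: "\<tau>2 \<in> lib_traces L2" "eval_trace f \<Gamma> \<tau>2 s0 = Val C'" "(s', \<omega>) \<in> C'"
    using lib_sem_ValD[OF s0(3,4)] .
  have "footprint s0 \<preceq> footprint \<sigma>0" and le: "hist_le ?G (history \<omega>)"
    using z(2) s0(1) by (simp_all add: bhist_le_def)
  \<comment> \<open>\<open>\<kappa>\<close> is the surplus of the first library's initial footprint
    over that of the second.\<close>
  then obtain \<kappa> c where \<kappa>: "s0 \<odot> \<kappa> = Some c" "footprint c = footprint \<sigma>0"
    using fp_le_footprintE by blast
  have len: "length ?H = length ?G" and es0: "es 0 = \<sigma>0'" and ls0: "footprint (ls 0) = footprint c"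
    using run \<kappa>(2) by (simp_all add: split_run_def)
  interpret split_execution f \<Gamma> \<Gamma>' ?H ?G ls es \<kappa>
    using fp sl spec(2) run by unfold_locales (auto simp: split_run_def)
  have kind: "fst (?H ! i) = fst (?G ! i) \<and> is_ret (snd (?H ! i)) = is_ret (snd (?G ! i))"
    if "i < length ?G" for i
    using split_steps[of i] that len by (auto elim: split_step.cases)
  obtain "is" where "is": "distinct is" "set is = {..<length ?H}" "history \<omega> = map ((!) ?G) is"
    "sorted_wrt (\<lambda>i j. \<not> is_ret (snd (?H ! i)) \<longrightarrow> is_ret (snd (?H ! j)) \<longrightarrow> i < j) is"
    "hist_le ?H (map ((!) ?H) is)"
    using hist_le_listing[OF le len kind] by blast
  \<comment> \<open>\<open>c\<close> inherits composability with \<open>\<sigma>0'\<close> from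
    \<open>\<sigma>0\<close>. Regrouping then yields the start \<open>T\<close> of the replay, and
    \<open>\<kappa>\<close> also witnesses the final comparison of footprints.\<close>
  obtain v where v: "c \<odot> \<sigma>0' = Some v" "footprint \<sigma> = footprint v"
    using footprint_eq_comp_right[OF \<kappa>(2)[symmetric] \<sigma>0(3)] .
  have "Some v = (Some s0 \<oplus> Some \<kappa>) \<oplus> Some \<sigma>0'" using \<kappa>(1) v(1) by simp
  also have "\<dots> = (Some s0 \<oplus> Some \<sigma>0') \<oplus> Some \<kappa>" by (simp only: ocomp_ac)
  finally obtain T where T: "s0 \<odot> \<sigma>0' = Some T" "T \<odot> \<kappa> = Some v"
    by (auto simp: ocomp_eq_Some_iff dest!: sym[of "Some v"])
  have T_in: "T \<in> I2 \<star> I" using T(1) s0(2) \<sigma>0(2) by (auto simp: pred_comp_def)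
  then have "lib_sem f L2 \<Gamma>' T \<noteq> Top" using assms(13) by (simp add: safe_for_def)
  from lib_sem_safe[OF this \<tau>2(1)] obtain D D' where D: "lib_sem f L2 \<Gamma>' T = Val D"
    "eval_trace f \<Gamma>' \<tau>2 T = Val D'" "\<forall>\<sigma>' \<mu>. (\<sigma>', \<mu>) \<in> D' \<longrightarrow> \<mu> \<in> D" .
  have "coupled 0 {} s0 T h" using coupled_initial[OF ls0 \<kappa>(1)] T(1) es0 by simp
  from replay[OF this \<tau>2(2,3) "is"(3) D(2) "is"(1) _ "is"(4)]
  obtain T' \<xi> where \<xi>: "(T', \<xi>) \<in> D'" "history \<xi> = map ((!) ?H) is" using "is"(2) by auto
  have y_in: "(footprint T, history \<xi>) \<in> interf f L2 \<Gamma>' (I2 \<star> I)"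
    using T_in D(1) D(3) \<xi>(1) unfolding interf_def by blast
  have "footprint T \<preceq> footprint \<sigma>"
    using fp_diff_footprint[OF T(2)] v(2) by (simp add: fp_le_def)
  then have "bhist_le x (footprint T, history \<xi>)"
    using interf_subset_balanced_histories[OF fp] x_in y_in x(1) "is"(5) \<xi>(2)
    unfolding bhist_le_def by auto
  then show "\<exists>y\<in>interf f L2 \<Gamma>' (I2 \<star> I). bhist_le x y" using y_in by blast
qed

end
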